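(* Let $1<p<\infty$ and $0\leq\lambda<n$. Then each of the operators $M^\sharp$, $H$ and $\mathcal{H}$ is bounded in $V^{(\ast)}L^{p,\lambda}(\mathbb{R}^n)$; that is, each maps $V^{(\ast)}L^{p,\lambda}(\mathbb{R}^n)$ into itself with $\|Tf\|_{p,\lambda}\leq C\|f\|_{p,\lambda}$ for a constant $C$ independent of $f$, where $T$ is any of these operators.
   Context: For $x\in\mathbb{R}^n$, $r>0$, let $B(x,r)$ be the open ball. The Morrey space $L^{p,\lambda}(\mathbb{R}^n)$ consists of all locally $p$-integrable $f$ on $\mathbb{R}^n$ with $\|f\|_{p,\lambda}:=\sup_{x\in\mathbb{R}^n,\,r>0}\left(\frac{1}{r^\lambda}\int_{B(x,r)}|f(y)|^p\,dy\right)^{1/p}<\infty$. The subspace $V^{(\ast)}L^{p,\lambda}(\mathbb{R}^n)$ consists of all $f\in L^{p,\lambda}(\mathbb{R}^n)$ with $$\lim_{N\to\infty}\ \sup_{x\in\mathbb{R}^n}\int_{B(x,1)}|f(y)|^p\,\chi_N(y)\,dy=0,\qquad \chi_N:=\chi_{\mathbb{R}^n\setminus B(0,N)},\ N\in\mathbb{N}.$$ Operators: - Sharp maximal function $M^\sharp f(x):=\sup_{t>0}\frac{1}{|B(x,t)|}\int_{B(x,t)}|f(y)-f_{B(x,t)}|\,dy$, where $f_B=\frac{1}{|B|}\int_B f(z)\,dz$. - Hardy operators $Hf(x):=\frac{1}{|x|^n}\int_{|y|<|x|}f(y)\,dy$ and $\mathcal{H}f(x):=\int_{|y|>|x|}\frac{f(y)}{|y|^n}\,dy$.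 *)

theory Defs
  imports "HOL-Analysis.Analysis"
begin

text \<open>Functions on \<open>\<real>\<^sup>n\<close> are represented by Lebesgue measurable representatives of type
  \<open>real ^ 'n \<Rightarrow> 'b\<close>; elements of the spaces are not quotiented by equality almost everywhere.\<close>

text \<open>\<open>((1 / r\<^sup>\<lambda>) \<integral>\<^sub>B\<^sub>(\<^sub>x\<^sub>,\<^sub>r\<^sub>) |f|\<^sup>p)\<^sup>1\<^sup>/\<^sup>p\<close>, to be used for \<open>r > 0\<close> and locally \<open>p\<close>-integrable \<open>f\<close>
  only, where the integral is not a default value.\<close>

definition morrey_quot ::
  "real \<Rightarrow> real \<Rightarrow> (real ^ 'n \<Rightarrow> 'b::{banach,second_countable_topology}) \<Rightarrow> real ^ 'n \<Rightarrow> real \<Rightarrow> real" where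
  "morrey_quot p l f x r =
     ((1 / r powr l) * (LINT y:ball x r|lebesgue. norm (f y) powr p)) powr (1 / p)"

definition morrey_norm ::
  "real \<Rightarrow> real \<Rightarrow> (real ^ 'n \<Rightarrow> 'b::{banach,second_countable_topology}) \<Rightarrow> real" where
  "morrey_norm p l f = (SUP (x, r) \<in> UNIV \<times> {0<..}. morrey_quot p l f x r)"

definition locally_p_integrable ::
  "real \<Rightarrow> (real ^ 'n \<Rightarrow> 'b::{banach,second_countable_topology}) \<Rightarrow> bool" where
  "locally_p_integrable p f \<longleftrightarrow> f \<in> borel_measurable lebesgue \<and>
     (\<forall>K. compact K \<longrightarrow> set_integrable lebesgue K (\<lambda>y. norm (f y) powr p))"

text \<open>Finiteness of the supremum is boundedness of the set of values, since \<open>Sup\<close> on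
  \<open>real\<close> is unspecified for unbounded sets.\<close>

definition morrey_space ::
  "real \<Rightarrow> real \<Rightarrow> (real ^ 'n \<Rightarrow> 'b::{banach,second_countable_topology}) set" where
  "morrey_space p l = {f. locally_p_integrable p f \<and>
     bdd_above ((\<lambda>(x, r). morrey_quot p l f x r) ` (UNIV \<times> {0<..}))}"

text \<open>For \<open>f\<close> in the Morrey space the suprema below are finite (take \<open>r = 1\<close> in the norm).\<close>

definition vanishing_morrey_space ::
  "real \<Rightarrow> real \<Rightarrow> (real ^ 'n \<Rightarrow> 'b::{banach,second_countable_topology}) set" where
  "vanishing_morrey_space p l = {f \<in> morrey_space p l.
     (\<lambda>N::nat. SUP x. LINT y:ball x 1|lebesgue.
        norm (f y) powr p * indicator (UNIV - ball 0 (real N)) y) \<longlonglongrightarrow> 0}"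

definition mean_on ::
  "(real ^ 'n) set \<Rightarrow> (real ^ 'n \<Rightarrow> 'b::{banach,second_countable_topology}) \<Rightarrow> 'b" where
  "mean_on B f = (1 / measure lebesgue B) *\<^sub>R (LINT z:B|lebesgue. f z)"

text \<open>The supremum may be infinite at individual points, hence the values in \<open>ennreal\<close>.\<close>

definition sharp_maximal ::
  "(real ^ 'n \<Rightarrow> 'b::{banach,second_countable_topology}) \<Rightarrow> real ^ 'n \<Rightarrow> ennreal" where
  "sharp_maximal f x = (SUP t\<in>{0<..}.
     (\<integral>\<^sup>+y\<in>ball x t. ennreal (norm (f y - mean_on (ball x t) f)) \<partial>lebesgue)
       / emeasure lebesgue (ball x t))"

text \<open>The value of the two Hardy operators at \<open>x = 0\<close> is an irrelevant default.\<close>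

definition hardy ::
  "(real ^ 'n \<Rightarrow> 'b::{banach,second_countable_topology}) \<Rightarrow> real ^ 'n \<Rightarrow> 'b" where
  "hardy f x = (1 / norm x ^ CARD('n)) *\<^sub>R (LINT y:{y. norm y < norm x}|lebesgue. f y)"

definition hardy_dual ::
  "(real ^ 'n \<Rightarrow> 'b::{banach,second_countable_topology}) \<Rightarrow> real ^ 'n \<Rightarrow> 'b" where
  "hardy_dual f x =
     (LINT y:{y. norm y > norm x}|lebesgue. (1 / norm y ^ CARD('n)) *\<^sub>R f y)"

text \<open>Bochner integrals default to \<open>0\<close> for non-integrable integrands. The following predicates say
  that the integrals defining an operator applied to \<open>f\<close> exist at (almost) every point, and,
  for the sharp maximal function, that the supremum is finite almost everywhere.\<close>

definition sharp_maximal_defined ::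
  "(real ^ 'n \<Rightarrow> 'b::{banach,second_countable_topology}) \<Rightarrow> bool" where
  "sharp_maximal_defined f \<longleftrightarrow>
     (\<forall>x t. set_integrable lebesgue (ball x t) f) \<and>
     (AE x in lebesgue. sharp_maximal f x < \<infinity>)"

definition hardy_defined ::
  "(real ^ 'n \<Rightarrow> 'b::{banach,second_countable_topology}) \<Rightarrow> bool" where
  "hardy_defined f \<longleftrightarrow>
     (AE x::real ^ 'n in lebesgue. set_integrable lebesgue {y. norm y < norm x} f)"

definition hardy_dual_defined ::
  "(real ^ 'n \<Rightarrow> 'b::{banach,second_countable_topology}) \<Rightarrow> bool" where
  "hardy_dual_defined f \<longleftrightarrow>
     (AE x::real ^ 'n in lebesgue. set_integrable lebesgue {y. norm y > norm x}
        (\<lambda>y. (1 / norm y ^ CARD('n)) *\<^sub>R f y))"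

text \<open>An operator \<open>T\<close>, with \<open>D f\<close> expressing that \<open>T f\<close> is well defined, is bounded in the
  vanishing Morrey space.\<close>

definition bounded_in_vanishing_morrey ::
  "real \<Rightarrow> real \<Rightarrow> ((real ^ 'n \<Rightarrow> 'b::{banach,second_countable_topology}) \<Rightarrow> bool) \<Rightarrow>
   ((real ^ 'n \<Rightarrow> 'b) \<Rightarrow> (real ^ 'n \<Rightarrow> 'c::{banach,second_countable_topology})) \<Rightarrow> bool" where
  "bounded_in_vanishing_morrey p l D T \<longleftrightarrow>
     (\<exists>C. \<forall>f \<in> vanishing_morrey_space p l.
        D f \<and> T f \<in> vanishing_morrey_space p l \<and>
        morrey_norm p l (T f) \<le> C * morrey_norm p l f)"

end

theory Submission
  imports Defs
begin

text \<open>\<open>M\<^sup>\<sharp> f\<close> and \<open>|H f|\<close> are pointwise at most constant multiples of the Hardy--Littlewood maximal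
  function \<open>M f\<close>. On a ball \<open>B(x,r)\<close>, \<open>M f\<close> is at most the maximum of \<open>M (f \<chi>\<^bsub>B(x,2r)\<^esub>)\<close>, whose
  \<open>L\<^sup>p\<close> norm is controlled by Vitali covering and interpolation, and of the averages of \<open>|f|\<close> over
  balls of radius \<open>> r\<close>. The Morrey norm bounds these averages by a multiple of
  \<open>r\<close> to the power \<open>(\<lambda> - n) / p\<close>, which gives boundedness. For the vanishing property take \<open>r = 1\<close>
  and a centre far from the origin: averages over radii \<open>> R\<close> are small because \<open>\<lambda> < n\<close>, and
  averages over radii in \<open>(1, R]\<close> because \<open>f\<close> itself is small far out.

  For the dual Hardy operator, Hoelder's inequality with a power weight bounds its \<open>p\<close>-th power by
  \<open>C |x|\<^sup>-\<^sup>e \<integral>\<^bsub>|y|>|x|\<^esub> |y|\<^sup>e\<^sup>-\<^sup>n |f|\<^sup>p\<close> with \<open>e = (n - \<lambda>) / 2\<close>. This is at most a multiple of \<open>|x|\<close> to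
  the power \<open>\<lambda> - n\<close>, which settles balls away from the origin and the vanishing property;
  exchanging the integrals settles balls around the origin (where the pointwise bound is not
  integrable if \<open>\<lambda> = 0\<close>).\<close>

subsection \<open>Weighted Hoelder inequality, weak type and interpolation\<close>

text \<open>The maximal function is never shown to be measurable. It enters only through measurable
  functions that it dominates up to a constant, so one argument serves
  \<open>M\<^sup>\<sharp>\<close> and \<open>H\<close> alike. The dual operator does not fit this
  scheme: a dyadic splitting of \<open>|y| > |x|\<close> gives an average of \<open>|f|\<close> at
  each of infinitely many scales, each controlled by \<open>M f\<close> but without decay, so the
  sum converges only by virtue of \<lambda> < n. Estimates use integrals valued in
  \<open>ennreal\<close>, where finiteness is a conclusion rather than a side condition, and an
  arbitrary \<open>A\<close> above the Morrey norm instead of the norm itself, so that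
  \<open>A\<close> is positive even for \<open>f = 0\<close>. That the Bochner integrals exist and
  the real suprema are finite is derived afterwards. Membership of the images in the space also
  demands measurability; it comes from continuity in \<open>x\<close> of integrals over moving balls
  and their exteriors.\<close>

lemma sigma_finite_lebesgue: "sigma_finite_measure (lebesgue :: 'a::euclidean_space measure)"
proof
  obtain A :: "'a set set" where "countable A" "A \<subseteq> sets lborel" "\<Union>A = space lborel"
    "\<forall>a\<in>A. emeasure lborel a \<noteq> \<infinity>"
    using lborel.sigma_finite_countable by blast
  then show "\<exists>A::'a set set. countable A \<and> A \<subseteq> sets lebesgue \<and> \<Union> A = space lebesgue \<and>
      (\<forall>a\<in>A. emeasure lebesgue a \<noteq> \<infinity>)"
    by (intro exI[of _ A]) (auto simp: subset_eq)
qed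

text \<open>The factor 2 is not sharp; it comes from integrating \<open>u \<le> d + d\<^sup>1\<^sup>-\<^sup>p u\<^sup>p\<close> and optimising in \<open>d\<close>.\<close>

lemma nn_integral_weighted_Hoelder:
  fixes u w :: "'a \<Rightarrow> real"
  assumes [measurable]: "u \<in> borel_measurable M" "w \<in> borel_measurable M"
    and u: "\<And>x. 0 \<le> u x" and w: "\<And>x. 0 \<le> w x" and p: "1 < p" and m: "0 < m" and I: "0 < I"
    and wm: "(\<integral>\<^sup>+x. ennreal (w x) \<partial>M) \<le> ennreal m"
    and uI: "(\<integral>\<^sup>+x. ennreal (u x powr p * w x) \<partial>M) \<le> ennreal I"
  shows "(\<integral>\<^sup>+x. ennreal (u x * w x) \<partial>M) \<le> ennreal (2 * m powr (1 - 1 / p) * I powr (1 / p))"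
proof -
  define d where "d = (I / m) powr (1 / p)"
  have d: "0 < d" using m I by (simp add: d_def)
  have pt: "u x \<le> d + d powr (1 - p) * u x powr p" for x
  proof (cases "u x \<le> d")
    case True
    moreover have "0 \<le> d powr (1 - p) * u x powr p" by simp
    ultimately show ?thesis by linarith
  next
    case False
    then have ux: "0 < u x" using d by linarith
    have "u x = u x powr (1 - p) * u x powr p"
      using ux by (simp flip: powr_add)
    also have "\<dots> \<le> d powr (1 - p) * u x powr p"
      using False d p by (intro mult_right_mono powr_mono2') auto
    finally show ?thesis using d by linarith
  qed
  have "(\<integral>\<^sup>+x. ennreal (u x * w x) \<partial>M)
      \<le> (\<integral>\<^sup>+x. ennreal d * ennreal (w x) + ennreal (d powr (1 - p)) * ennreal (u x powr p * w x) \<partial>M)"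
  proof (rule nn_integral_mono)
    fix x
    have "u x * w x \<le> (d + d powr (1 - p) * u x powr p) * w x"
      by (intro mult_right_mono pt w)
    then have "ennreal (u x * w x) \<le> ennreal (d * w x + d powr (1 - p) * (u x powr p * w x))"
      by (intro ennreal_leI) (simp add: algebra_simps)
    also have "\<dots> = ennreal d * ennreal (w x) + ennreal (d powr (1 - p)) * ennreal (u x powr p * w x)"
      using d w u by (subst ennreal_plus) (auto simp: ennreal_mult)
    finally show "ennreal (u x * w x) \<le> \<dots>" .
  qed
  also have "\<dots> = ennreal d * (\<integral>\<^sup>+x. ennreal (w x) \<partial>M)
      + ennreal (d powr (1 - p)) * (\<integral>\<^sup>+x. ennreal (u x powr p * w x) \<partial>M)"
    by (subst nn_integral_add) (auto simp: nn_integral_cmult)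
  also have "\<dots> \<le> ennreal d * ennreal m + ennreal (d powr (1 - p)) * ennreal I"
    by (intro add_mono mult_left_mono wm uI) auto
  also have "\<dots> = ennreal (d * m + d powr (1 - p) * I)"
    using d m I by (simp add: ennreal_mult)
  also have "d * m = m powr (1 - 1 / p) * I powr (1 / p)"
    using m I by (simp add: d_def powr_divide powr_diff)
  also have "d powr (1 - p) * I = m powr (1 - 1 / p) * I powr (1 / p)"
  proof -
    have e: "(1 / p) * (1 - p) = 1 / p - 1" using p by (simp add: field_simps)
    have "d powr (1 - p) = (I / m) powr (1 / p - 1)"
      unfolding d_def powr_powr e ..
    then show ?thesis using m I by (simp add: powr_divide powr_diff)
  qed
  finally show ?thesis by (simp add: mult_ac)
qed

text \<open>The integral of \<open>u * w\<close> may a priori be infinite, so the bound is stated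
  for each real \<open>K\<close> below it, and only real numbers are raised to the power
  \<open>p\<close>. In this form it can also prove that the integral is finite.\<close>

lemma nn_integral_weighted_Hoelder_powr:
  fixes u w :: "'a \<Rightarrow> real"
  assumes [measurable]: "u \<in> borel_measurable M" "w \<in> borel_measurable M"
    and u: "\<And>x. 0 \<le> u x" and w: "\<And>x. 0 \<le> w x" and p: "1 < p" and m: "0 < m"
    and wm: "(\<integral>\<^sup>+x. ennreal (w x) \<partial>M) \<le> ennreal m"
    and K: "0 \<le> K" "ennreal K \<le> (\<integral>\<^sup>+x. ennreal (u x * w x) \<partial>M)"
  shows "ennreal (K powr p) \<le> ennreal (2 powr p * m powr (p - 1)) * (\<integral>\<^sup>+x. ennreal (u x powr p * w x) \<partial>M)"
proof (cases "(\<integral>\<^sup>+x. ennreal (u x powr p * w x) \<partial>M)")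
  case (real I)
  \<comment> \<open>The preceding lemma asks for a positive bound, while \<open>I\<close> may be
    \<open>0\<close>; hence every \<open>J > I\<close> is used and \<open>J\<close> then tends to
    \<open>I\<close>.\<close>
  have "K powr p \<le> 2 powr p * m powr (p - 1) * J" if J: "I < J" for J
  proof -
    have J0: "0 < J" using J real by linarith
    have "(\<integral>\<^sup>+x. ennreal (u x powr p * w x) \<partial>M) \<le> ennreal J"
      using J real by (simp add: ennreal_leI)
    from order_trans[OF K(2) nn_integral_weighted_Hoelder[OF assms(1,2) u w p m J0 wm this]]
    have "ennreal K \<le> ennreal (2 * m powr (1 - 1 / p) * J powr (1 / p))" .
    then have "K \<le> 2 * m powr (1 - 1 / p) * J powr (1 / p)"
      by (subst (asm) ennreal_le_iff) auto
    then have "K powr p \<le> (2 * m powr (1 - 1 / p) * J powr (1 / p)) powr p"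
      using K p by (intro powr_mono2) auto
    also have "\<dots> = 2 powr p * m powr (p - 1) * J"
      using J0 m p by (simp add: powr_mult powr_powr algebra_simps)
    finally show ?thesis .
  qed
  then have "K powr p / (2 powr p * m powr (p - 1)) \<le> J" if "I < J" for J
    using that m by (simp add: field_simps)
  then have "K powr p / (2 powr p * m powr (p - 1)) \<le> I"
    by (rule dense_ge)
  then have "K powr p \<le> 2 powr p * m powr (p - 1) * I"
    using m by (simp add: field_simps)
  then show ?thesis
    using real by (auto simp flip: ennreal_mult intro!: ennreal_leI)
next
  case top
  then show ?thesis using m by (simp add: ennreal_mult_top)
qed

lemma nn_integral_powr_Ioo:
  assumes "-1 < q" "0 \<le> s"
  shows "(\<integral>\<^sup>+a. ennreal (a powr q) * indicator {0<..<s} a \<partial>lborel) = ennreal (s powr (q + 1) / (q + 1))"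
  using has_integral_powr_from_0[OF assms]
  by (intro nn_integral_has_integral_lebesgue') (auto simp: has_integral_Icc_iff_Ioo)

text \<open>Marcinkiewicz interpolation between weak \<open>(1,1)\<close> and \<open>(\<infinity>,\<infinity>)\<close>: the cut-off at height \<open>a / 2\<close> in the
  hypothesis already encodes the trivial \<open>L\<^sup>\<infinity>\<close> bound.\<close>

lemma nn_integral_powr_le_of_level_sets:
  fixes h u :: "'a \<Rightarrow> real"
  assumes M: "sigma_finite_measure M"
    and [measurable]: "h \<in> borel_measurable M" "u \<in> borel_measurable M"
    and h: "\<And>x. 0 \<le> h x" and u: "\<And>x. 0 \<le> u x" and p: "1 < p"
    and weak: "\<And>a. 0 < a \<Longrightarrow> ennreal a * emeasure M {x \<in> space M. a < h x}
        \<le> A * (\<integral>\<^sup>+x. ennreal (u x) * indicator {x. a / 2 < u x} x \<partial>M)"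
  shows "(\<integral>\<^sup>+x. ennreal (h x powr p) \<partial>M)
      \<le> A * ennreal (p * 2 powr (p - 1) / (p - 1)) * (\<integral>\<^sup>+x. ennreal (u x powr p) \<partial>M)"
proof -
  interpret sigma_finite_measure M by fact
  interpret P: pair_sigma_finite M "lborel :: real measure" ..
  have hp: "ennreal (h x powr p)
      = (\<integral>\<^sup>+a. ennreal p * (ennreal (a powr (p - 1)) * indicator {0<..<h x} a) \<partial>lborel)" for x
    using nn_integral_powr_Ioo[of "p - 1" "h x"] h p
    by (simp add: nn_integral_cmult flip: ennreal_mult)
  have "(\<integral>\<^sup>+x. ennreal (h x powr p) \<partial>M)
      = (\<integral>\<^sup>+x. (\<integral>\<^sup>+a. ennreal p * (ennreal (a powr (p - 1)) * indicator {0<..<h x} a) \<partial>lborel) \<partial>M)"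
    by (simp add: hp)
  also have "\<dots> = (\<integral>\<^sup>+a. (\<integral>\<^sup>+x. ennreal p * (ennreal (a powr (p - 1)) * indicator {0<..<h x} a) \<partial>M) \<partial>lborel)"
    by (subst P.Fubini'[symmetric]) (auto simp: case_prod_beta' indicator_def)
  \<comment> \<open>Of the weight \<open>a powr (p - 1)\<close> one factor \<open>a\<close> is spent
    on the weak-type hypothesis, leaving \<open>a powr (p - 2)\<close>, which is integrable at
    \<open>0\<close> because \<open>p > 1\<close>. The cut-off \<open>a / 2 < u x\<close> reads
    \<open>a < 2 * u x\<close>, so the second exchange of integrals again produces a power integral
    over an interval.\<close>
  also have "\<dots> \<le> (\<integral>\<^sup>+a. (\<integral>\<^sup>+x. A * (ennreal p * ennreal (u x) * (ennreal (a powr (p - 2)) * indicator {0<..<2 * u x} a)) \<partial>M) \<partial>lborel)"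
  proof (rule nn_integral_mono)
    fix a :: real
    show "(\<integral>\<^sup>+x. ennreal p * (ennreal (a powr (p - 1)) * indicator {0<..<h x} a) \<partial>M)
      \<le> (\<integral>\<^sup>+x. A * (ennreal p * ennreal (u x) * (ennreal (a powr (p - 2)) * indicator {0<..<2 * u x} a)) \<partial>M)"
    proof (cases "0 < a")
      case True
      have a1: "ennreal (a powr (p - 1)) = ennreal (a powr (p - 2)) * ennreal a"
        using True powr_add[of a "p - 2" 1] by (simp flip: ennreal_mult)
      have "(\<integral>\<^sup>+x. ennreal p * (ennreal (a powr (p - 1)) * indicator {0<..<h x} a) \<partial>M)
          = (\<integral>\<^sup>+x. ennreal p * ennreal (a powr (p - 1)) * indicator {x \<in> space M. a < h x} x \<partial>M)"
        using True by (intro nn_integral_cong) (auto simp: indicator_def)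
      also have "\<dots> = ennreal p * ennreal (a powr (p - 2)) * (ennreal a * emeasure M {x \<in> space M. a < h x})"
        by (subst nn_integral_cmult_indicator) (auto simp: a1 mult_ac)
      also have "\<dots> \<le> ennreal p * ennreal (a powr (p - 2)) *
          (A * (\<integral>\<^sup>+x. ennreal (u x) * indicator {x. a / 2 < u x} x \<partial>M))"
        by (intro mult_left_mono weak True) auto
      also have "\<dots> = (\<integral>\<^sup>+x. ennreal p * ennreal (a powr (p - 2)) * A * (ennreal (u x) * indicator {x. a / 2 < u x} x) \<partial>M)"
        by (subst nn_integral_cmult) (auto simp: mult_ac)
      also have "\<dots> = (\<integral>\<^sup>+x. A * (ennreal p * ennreal (u x) * (ennreal (a powr (p - 2)) * indicator {0<..<2 * u x} a)) \<partial>M)"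
        using True by (intro nn_integral_cong) (auto simp: indicator_def mult_ac)
      finally show ?thesis .
    qed (auto simp: indicator_def)
  qed
  also have "\<dots> = (\<integral>\<^sup>+x. (\<integral>\<^sup>+a. A * (ennreal p * ennreal (u x) * (ennreal (a powr (p - 2)) * indicator {0<..<2 * u x} a)) \<partial>lborel) \<partial>M)"
    by (subst P.Fubini'[symmetric]) (auto simp: case_prod_beta' indicator_def)
  also have "\<dots> = (\<integral>\<^sup>+x. A * ennreal (p * 2 powr (p - 1) / (p - 1)) * ennreal (u x powr p) \<partial>M)"
  proof (rule nn_integral_cong)
    fix x
    have "(\<integral>\<^sup>+a. A * (ennreal p * ennreal (u x) * (ennreal (a powr (p - 2)) * indicator {0<..<2 * u x} a)) \<partial>lborel)
      = A * (ennreal p * ennreal (u x) * ennreal ((2 * u x) powr (p - 1) / (p - 1)))"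
      using nn_integral_powr_Ioo[of "p - 2" "2 * u x"] u p by (simp add: nn_integral_cmult)
    also have "ennreal p * ennreal (u x) * ennreal ((2 * u x) powr (p - 1) / (p - 1))
        = ennreal (p * u x * ((2 * u x) powr (p - 1) / (p - 1)))"
      using p u by (subst ennreal_mult[symmetric], simp, simp)+ (simp add: mult_ac)
    also have "p * u x * ((2 * u x) powr (p - 1) / (p - 1)) = (p * 2 powr (p - 1) / (p - 1)) * u x powr p"
      using u[of x] powr_add[of "u x" 1 "p - 1"] by (cases "u x = 0") (auto simp: powr_mult)
    also have "ennreal \<dots> = ennreal (p * 2 powr (p - 1) / (p - 1)) * ennreal (u x powr p)"
      using p by (intro ennreal_mult) auto
    finally show "(\<integral>\<^sup>+a. A * (ennreal p * ennreal (u x) * (ennreal (a powr (p - 2)) * indicator {0<..<2 * u x} a)) \<partial>lborel)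
      = A * ennreal (p * 2 powr (p - 1) / (p - 1)) * ennreal (u x powr p)"
      by (simp only: mult.assoc)
  qed
  also have "\<dots> = A * ennreal (p * 2 powr (p - 1) / (p - 1)) * (\<integral>\<^sup>+x. ennreal (u x powr p) \<partial>M)"
    by (rule nn_integral_cmult) auto
  finally show ?thesis .
qed

text \<open>Vitali covering: the balls of average at least \<open>a\<close> around the points of
  \<open>E\<close> contain a countable disjoint subfamily whose fivefold enlargements cover
  \<open>E\<close>, and enlarging costs the factor \<open>5 ^ DIM('a)\<close>. Since
  \<open>E\<close> is any measurable set with this property, no level set of a maximal function has
  to be measurable.\<close>

lemma weak_type_maximal:
  fixes v :: "'a::euclidean_space \<Rightarrow> ennreal"
  assumes [measurable]: "v \<in> borel_measurable lebesgue" and E: "E \<in> sets lebesgue" and a: "0 < a"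
    and avg: "\<And>y. y \<in> E \<Longrightarrow> \<exists>t>0. ennreal a * emeasure lebesgue (ball y t) \<le> (\<integral>\<^sup>+z\<in>ball y t. v z \<partial>lebesgue)"
  shows "ennreal a * emeasure lebesgue E \<le> 5 ^ DIM('a) * (\<integral>\<^sup>+z. v z \<partial>lebesgue)"
proof (cases "(\<integral>\<^sup>+z. v z \<partial>lebesgue)")
  case (real I)
  let ?n = "DIM('a)"
  define V where "V = unit_ball_vol ?n"
  have V: "0 < V" by (simp add: V_def)
  obtain r where r: "\<And>y. y \<in> E \<Longrightarrow> 0 < r y"
    and avg: "\<And>y. y \<in> E \<Longrightarrow> ennreal a * emeasure lebesgue (ball y (r y)) \<le> (\<integral>\<^sup>+z\<in>ball y (r y). v z \<partial>lebesgue)"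
    using bchoice[of E "\<lambda>y t. 0 < t \<and> ennreal a * emeasure lebesgue (ball y t) \<le> (\<integral>\<^sup>+z\<in>ball y t. v z \<partial>lebesgue)"] avg
    by blast
  \<comment> \<open>The covering lemma needs bounded radii. An average of at least \<open>a\<close>
    over a ball bounds its volume by \<open>I / a\<close>, and \<open>r y \<le> r y ^ ?n\<close> for
    \<open>r y > 1\<close> turns this into a bound on the radius.\<close>
  have rB: "r y \<le> max 1 (I / (a * V))" if y: "y \<in> E" for y
  proof (cases "r y \<le> 1")
    case False
    have "ennreal (a * (V * r y ^ ?n)) = ennreal a * emeasure lebesgue (ball y (r y))"
      using r[OF y] a V by (simp add: emeasure_ball V_def ennreal_mult)
    also have "\<dots> \<le> (\<integral>\<^sup>+z\<in>ball y (r y). v z \<partial>lebesgue)" by (rule avg[OF y])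
    also have "\<dots> \<le> (\<integral>\<^sup>+z. v z \<partial>lebesgue)"
      by (intro nn_integral_mono) (auto simp: indicator_def)
    finally have "a * (V * r y ^ ?n) \<le> I"
      using real by simp
    then have "r y ^ ?n \<le> I / (a * V)" using a V by (simp add: field_simps)
    moreover have "r y ^ 1 \<le> r y ^ ?n"
      using False by (intro power_increasing) (auto simp: Suc_leI)
    ultimately show ?thesis by simp
  qed auto
  obtain C where C: "countable C" "C \<subseteq> E"
     "pairwise (\<lambda>i j. disjnt (cball i (r i)) (cball j (r j))) C"
     "\<And>i. i \<in> E \<Longrightarrow> \<exists>j. j \<in> C \<and> \<not> disjnt (cball i (r i)) (cball j (r j)) \<and>
                        cball i (r i) \<subseteq> ball j (5 * r j)"
    using Vitali_covering_lemma_cballs_balls[of E r "max 1 (I / (a * V))" "\<lambda>x. x"] r rB by blast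
  define F where "F k c = (if k \<in> to_nat_on C ` C then ball (from_nat_into C k) (c * r (from_nat_into C k)) else {})"
    for k c
  have F_meas [measurable]: "F k c \<in> sets lebesgue" for k c
    by (auto simp: F_def)
  have disj: "disjoint_family (\<lambda>k. F k 1)"
    unfolding disjoint_family_on_def
  proof (intro ballI impI)
    fix k l :: nat assume "k \<noteq> l"
    show "F k 1 \<inter> F l 1 = {}"
    proof (cases "k \<in> to_nat_on C ` C \<and> l \<in> to_nat_on C ` C")
      case True
      then obtain x y where xy: "x \<in> C" "y \<in> C" "k = to_nat_on C x" "l = to_nat_on C y" by auto
      then have "x \<noteq> y" using \<open>k \<noteq> l\<close> by auto
      then have "disjnt (cball x (r x)) (cball y (r y))"
        using C(3) xy by (auto simp: pairwise_def)
      then have "ball x (r x) \<inter> ball y (r y) = {}"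
        using ball_subset_cball[of x "r x"] ball_subset_cball[of y "r y"]
        unfolding disjnt_def by blast
      then show ?thesis using xy C(1) by (simp add: F_def)
    qed (auto simp: F_def)
  qed
  have "E \<subseteq> (\<Union>k. F k 5)"
  proof
    fix x assume x: "x \<in> E"
    then obtain j where j: "j \<in> C" "cball x (r x) \<subseteq> ball j (5 * r j)" using C(4) by blast
    moreover have "x \<in> cball x (r x)" using r[OF x] by simp
    ultimately have "x \<in> ball j (5 * r j)" by blast
    then have "x \<in> F (to_nat_on C j) 5" using j(1) C(1) by (auto simp: F_def)
    then show "x \<in> (\<Union>k. F k 5)" by blast
  qed
  then have "emeasure lebesgue E \<le> emeasure lebesgue (\<Union>k. F k 5)"
    by (intro emeasure_mono) auto
  also have "\<dots> \<le> (\<Sum>k. emeasure lebesgue (F k 5))"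
    by (intro emeasure_subadditive_countably) auto
  finally have "ennreal a * emeasure lebesgue E \<le> (\<Sum>k. ennreal a * emeasure lebesgue (F k 5))"
    by (simp add: mult_left_mono)
  also have "\<dots> \<le> (\<Sum>k. 5 ^ ?n * (\<integral>\<^sup>+z\<in>F k 1. v z \<partial>lebesgue))"
  proof (intro suminf_le summableI)
    fix k
    show "ennreal a * emeasure lebesgue (F k 5) \<le> 5 ^ ?n * (\<integral>\<^sup>+z\<in>F k 1. v z \<partial>lebesgue)"
    proof (cases "k \<in> to_nat_on C ` C")
      case True
      then obtain x where x: "x \<in> C" "k = to_nat_on C x" by auto
      then have xE: "x \<in> E" using C by auto
      have "emeasure lebesgue (ball x (5 * r x)) = 5 ^ ?n * emeasure lebesgue (ball x (r x))"
      proof -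
        have "emeasure lebesgue (ball x (5 * r x)) = ennreal (5 ^ ?n * (V * r x ^ ?n))"
          using r[OF xE] by (simp add: emeasure_ball power_mult_distrib V_def mult_ac)
        also have "\<dots> = ennreal (5 ^ ?n) * emeasure lebesgue (ball x (r x))"
          using r[OF xE] V by (simp add: emeasure_ball V_def ennreal_mult)
        finally show ?thesis by (simp flip: ennreal_power)
      qed
      then have "ennreal a * emeasure lebesgue (F k 5) = 5 ^ ?n * (ennreal a * emeasure lebesgue (ball x (r x)))"
        using x C(1) by (simp add: F_def mult_ac)
      also have "\<dots> \<le> 5 ^ ?n * (\<integral>\<^sup>+z\<in>ball x (r x). v z \<partial>lebesgue)"
        by (intro mult_left_mono avg xE) auto
      finally show ?thesis using x C(1) by (simp add: F_def)
    qed (auto simp: F_def)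
  qed
  also have "\<dots> = 5 ^ ?n * (\<Sum>k. (\<integral>\<^sup>+z\<in>F k 1. v z \<partial>lebesgue))"
    by simp
  also have "(\<Sum>k. (\<integral>\<^sup>+z\<in>F k 1. v z \<partial>lebesgue)) = (\<integral>\<^sup>+z\<in>(\<Union>k. F k 1). v z \<partial>lebesgue)"
    by (rule nn_integral_disjoint_family[symmetric, OF _ _ disj]) auto
  also have "\<dots> \<le> (\<integral>\<^sup>+z. v z \<partial>lebesgue)"
    by (intro nn_integral_mono) (auto simp: indicator_def)
  finally show ?thesis by (simp add: mult_left_mono)
next
  case top
  then show ?thesis by (simp add: ennreal_mult_top)
qed

subsection \<open>Integrals over balls and dyadic annuli\<close>

lemma borel_measurable_lebesgue_ident:
  "(\<lambda>x. x) \<in> borel_measurable (lebesgue :: 'a::euclidean_space measure)"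
  by (rule measurable_completion) simp

lemma borel_measurable_lebesgue_norm:
  "(norm :: 'a::euclidean_space \<Rightarrow> real) \<in> borel_measurable lebesgue"
  by (rule measurable_completion) simp

lemma pred_lebesgue_ball [measurable]:
  fixes x :: "'a::euclidean_space"
  shows "Measurable.pred lebesgue (\<lambda>y. y \<in> ball x r)" "Measurable.pred lebesgue (\<lambda>y. y \<in> cball x r)"
  unfolding pred_def by simp_all

text \<open>Averaging instead of covering: integrating over all centres \<open>z\<close> counts
  every point \<open>w\<close> with the volume of the unit ball, and only centres in
  \<open>ball y (t + 1)\<close> see points of \<open>ball y t\<close>. Comparing volumes gives the
  factor \<open>(t + 1) ^ DIM('a)\<close>.\<close>

lemma nn_integral_ball_le_of_unit_balls:
  fixes v :: "'a::euclidean_space \<Rightarrow> ennreal"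
  assumes [measurable]: "v \<in> borel_measurable lebesgue"
    and d: "\<And>z. (\<integral>\<^sup>+w\<in>ball z 1. v w \<partial>lebesgue) \<le> d" and t: "0 < t"
  shows "(\<integral>\<^sup>+w\<in>ball y t. v w \<partial>lebesgue) \<le> ennreal ((t + 1) ^ DIM('a)) * d"
proof -
  let ?n = "DIM('a)"
  define V where "V = unit_ball_vol ?n"
  have V: "0 < V" by (simp add: V_def)
  interpret L: sigma_finite_measure "lebesgue :: 'a measure" by (rule sigma_finite_lebesgue)
  interpret P: pair_sigma_finite "lebesgue :: 'a measure" "lebesgue :: 'a measure" ..
  have [measurable]: "fst \<in> borel_measurable (lebesgue \<Otimes>\<^sub>M lebesgue :: ('a \<times> 'a) measure)"
    "snd \<in> borel_measurable (lebesgue \<Otimes>\<^sub>M lebesgue :: ('a \<times> 'a) measure)"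
    using measurable_compose[OF measurable_fst borel_measurable_lebesgue_ident]
      measurable_compose[OF measurable_snd borel_measurable_lebesgue_ident] by auto
  have [measurable]: "(\<lambda>q. indicator (ball (fst q) 1) (snd q) :: ennreal) \<in>
      borel_measurable (lebesgue \<Otimes>\<^sub>M lebesgue :: ('a \<times> 'a) measure)"
    unfolding indicator_def mem_ball by measurable
  have [measurable]: "(\<lambda>q. v (fst q)) \<in> borel_measurable (lebesgue \<Otimes>\<^sub>M lebesgue :: ('a \<times> 'a) measure)"
    by (rule measurable_compose[OF measurable_fst]) measurable
  have [measurable]: "(\<lambda>q. indicator (ball y t) (fst q) :: ennreal) \<in>
      borel_measurable (lebesgue \<Otimes>\<^sub>M lebesgue :: ('a \<times> 'a) measure)"
    by (rule measurable_compose[OF measurable_fst]) measurable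
  have "ennreal V * (\<integral>\<^sup>+w\<in>ball y t. v w \<partial>lebesgue) = (\<integral>\<^sup>+w. ennreal V * (v w * indicator (ball y t) w) \<partial>lebesgue)"
    by (rule nn_integral_cmult[symmetric]) auto
  also have "\<dots> = (\<integral>\<^sup>+w. (\<integral>\<^sup>+z. v w * indicator (ball y t) w * indicator (ball w 1) z \<partial>lebesgue) \<partial>lebesgue)"
  proof (rule nn_integral_cong)
    fix w :: 'a
    show "ennreal V * (v w * indicator (ball y t) w)
        = (\<integral>\<^sup>+z. v w * indicator (ball y t) w * indicator (ball w 1) z \<partial>lebesgue)"
      by (subst nn_integral_cmult_indicator) (auto simp: emeasure_ball V_def mult_ac)
  qed
  also have "\<dots> = (\<integral>\<^sup>+z. (\<integral>\<^sup>+w. v w * indicator (ball y t) w * indicator (ball w 1) z \<partial>lebesgue) \<partial>lebesgue)"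
    by (subst P.Fubini') (auto simp: case_prod_beta')
  also have "\<dots> \<le> (\<integral>\<^sup>+z. d * indicator (ball y (t + 1)) z \<partial>lebesgue)"
  proof (rule nn_integral_mono)
    fix z :: 'a
    show "(\<integral>\<^sup>+w. v w * indicator (ball y t) w * indicator (ball w 1) z \<partial>lebesgue)
      \<le> d * indicator (ball y (t + 1)) z"
    proof (cases "z \<in> ball y (t + 1)")
      case True
      have "(\<integral>\<^sup>+w. v w * indicator (ball y t) w * indicator (ball w 1) z \<partial>lebesgue)
          \<le> (\<integral>\<^sup>+w\<in>ball z 1. v w \<partial>lebesgue)"
        by (intro nn_integral_mono) (auto simp: indicator_def dist_commute)
      with d[of z] True show ?thesis by auto
    next
      case False
      then have "v w * indicator (ball y t) w * indicator (ball w 1) z = 0" for w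
        using dist_triangle[of y z w] by (auto simp: indicator_def)
      then show ?thesis by (simp only: nn_integral_const) simp
    qed
  qed
  also have "\<dots> = d * emeasure lebesgue (ball y (t + 1))"
    by (rule nn_integral_cmult_indicator) auto
  also have "\<dots> = ennreal V * (ennreal ((t + 1) ^ ?n) * d)"
    using t V by (simp add: emeasure_ball V_def ennreal_mult mult_ac)
  finally show ?thesis
    using V by (subst (asm) ennreal_mult_le_mult_iff) auto
qed

lemma ex_powr_2_between:
  fixes x :: real
  assumes "1 \<le> x"
  obtains k :: nat where "2 powr real k \<le> x" "x < 2 powr (real k + 1)"
proof
  have "0 \<le> log 2 x" using assms by simp
  then have k: "real (nat \<lfloor>log 2 x\<rfloor>) \<le> log 2 x" "log 2 x < real (nat \<lfloor>log 2 x\<rfloor>) + 1" by linarith+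
  show "2 powr real (nat \<lfloor>log 2 x\<rfloor>) \<le> x"
    using iffD1[OF le_log_iff k(1)] assms by simp
  show "x < 2 powr (real (nat \<lfloor>log 2 x\<rfloor>) + 1)"
    using iffD1[OF log_less_iff k(2)] assms by simp
qed

lemma suminf_ennreal_geometric:
  fixes c q :: real
  assumes "0 \<le> c" "0 \<le> q" "q < 1"
  shows "(\<Sum>k. ennreal (c * q ^ k)) = ennreal (c / (1 - q))"
proof -
  have "(\<lambda>k. c * q ^ k) sums (c * (1 / (1 - q)))"
    using assms by (intro sums_mult geometric_sums) auto
  then show ?thesis
    using assms by (subst suminf_ennreal2) (auto simp: sums_iff)
qed

text \<open>On the annulus \<open>2^k s \<le> |y| < 2^(k+1) s\<close> the weight is at most
  \<open>(2^k s)^(-b)\<close> and the mass at most \<open>A (2^(k+1) s)^l\<close>; the products form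
  a geometric series of ratio \<open>2 powr (l - b) < 1\<close>. The density \<open>v\<close> is
  general because both \<open>|f|^p\<close> and the constant \<open>1\<close>, with
  \<open>l = n\<close>, occur.\<close>

lemma nn_integral_powr_tail:
  fixes v :: "'a::euclidean_space \<Rightarrow> ennreal"
  assumes [measurable]: "v \<in> borel_measurable lebesgue"
    and l: "0 \<le> l" "l < b" and A: "0 \<le> A" and s: "0 < s"
    and v: "\<And>t. 0 < t \<Longrightarrow> (\<integral>\<^sup>+y\<in>ball 0 t. v y \<partial>lebesgue) \<le> ennreal (A * t powr l)"
  shows "(\<integral>\<^sup>+y\<in>{y. s \<le> norm y}. ennreal (norm y powr - b) * v y \<partial>lebesgue)
    \<le> ennreal (A * (2 powr l / (1 - 2 powr (l - b))) * s powr (l - b))"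
proof -
  define f where "f k y = ennreal ((2 powr real k * s) powr - b) * (v y * indicator (ball 0 (2 powr (real k + 1) * s)) y)"
    for k and y :: 'a
  have [measurable]: "f k \<in> borel_measurable lebesgue" for k
    unfolding f_def by (intro borel_measurable_times_ennreal borel_measurable_const borel_measurable_indicator) auto
  have "(\<integral>\<^sup>+y\<in>{y. s \<le> norm y}. ennreal (norm y powr - b) * v y \<partial>lebesgue) \<le> (\<integral>\<^sup>+y. (\<Sum>k. f k y) \<partial>lebesgue)"
  proof (rule nn_integral_mono)
    fix y :: 'a
    show "ennreal (norm y powr - b) * v y * indicator {y. s \<le> norm y} y \<le> (\<Sum>k. f k y)"
    proof (cases "s \<le> norm y")
      case True
      then have "1 \<le> norm y / s" using s by simp
      then obtain k :: nat where k: "2 powr real k \<le> norm y / s" "norm y / s < 2 powr (real k + 1)"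
        by (rule ex_powr_2_between)
      then have k': "2 powr real k * s \<le> norm y" "norm y < 2 powr (real k + 1) * s"
        using s by (simp_all add: field_simps)
      have "ennreal (norm y powr - b) \<le> ennreal ((2 powr real k * s) powr - b)"
        using k' s l by (intro ennreal_leI powr_mono2') auto
      then have "ennreal (norm y powr - b) * v y * indicator {y. s \<le> norm y} y \<le> f k y"
        using True k' by (auto simp: f_def indicator_def intro: mult_right_mono)
      also have "f k y \<le> (\<Sum>k. f k y)"
        using sum_le_suminf[of "\<lambda>k. f k y" "{k}"] by (simp add: summableI)
      finally show ?thesis .
    qed auto
  qed
  also have "\<dots> = (\<Sum>k. \<integral>\<^sup>+y. f k y \<partial>lebesgue)"
    by (rule nn_integral_suminf) auto
  also have "\<dots> \<le> (\<Sum>k. ennreal (A * 2 powr l * s powr (l - b) * (2 powr (l - b)) ^ k))"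
  proof (intro suminf_le summableI)
    fix k
    have "(\<integral>\<^sup>+y. f k y \<partial>lebesgue)
        = ennreal ((2 powr real k * s) powr - b) * (\<integral>\<^sup>+y\<in>ball 0 (2 powr (real k + 1) * s). v y \<partial>lebesgue)"
      unfolding f_def by (rule nn_integral_cmult) measurable
    also have "\<dots> \<le> ennreal ((2 powr real k * s) powr - b) * ennreal (A * (2 powr (real k + 1) * s) powr l)"
      using s by (intro mult_left_mono v) auto
    also have "\<dots> = ennreal ((2 powr real k * s) powr - b * (A * (2 powr (real k + 1) * s) powr l))"
      using A by (intro ennreal_mult[symmetric]) auto
    also have "(2 powr real k * s) powr - b * (A * (2 powr (real k + 1) * s) powr l)
        = A * 2 powr l * s powr (l - b) * (2 powr (l - b)) ^ k"
    proof -
      have "(2 powr (l - b)) ^ k = 2 powr (real k * (l - b))"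
        by (simp add: powr_powr mult.commute flip: powr_realpow)
      also have "real k * (l - b) = real k * l + - (real k * b)"
        by (simp add: algebra_simps)
      finally have e1: "(2 powr (l - b)) ^ k = 2 powr (real k * l) * 2 powr (- (real k * b))"
        by (simp only: powr_add)
      have e2: "s powr (l - b) = s powr l * s powr - b"
        using powr_add[of s l "- b"] by simp
      have e3: "(2 powr real k * s) powr - b = 2 powr (- (real k * b)) * s powr - b"
        using s by (simp add: powr_mult powr_powr)
      have "(real k + 1) * l = real k * l + l" by (simp add: algebra_simps)
      then have e4: "(2 powr (real k + 1) * s) powr l = 2 powr (real k * l) * 2 powr l * s powr l"
        using s by (simp only: powr_mult powr_powr powr_add mult_1)
      show ?thesis unfolding e1 e2 e3 e4 by (simp only: mult_ac)
    qed
    finally show "(\<integral>\<^sup>+y. f k y \<partial>lebesgue) \<le> ennreal (A * 2 powr l * s powr (l - b) * (2 powr (l - b)) ^ k)" .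
  qed
  also have "\<dots> = ennreal (A * 2 powr l * s powr (l - b) / (1 - 2 powr (l - b)))"
    using l A by (intro suminf_ennreal_geometric) (auto simp: powr_less_one)
  finally show ?thesis by (simp add: mult_ac)
qed

text \<open>The same decomposition, now shrinking to the origin: the volume of the
  \<open>k\<close>-th ball contributes \<open>2^(-k n)\<close> against \<open>2^(k c)\<close> from
  the weight, which sums because \<open>c < n\<close>. The balls are closed because the dyadic
  choice gives only \<open>norm y \<le> 2 powr - k * s\<close>.\<close>

lemma nn_integral_powr_ball:
  fixes c s :: real
  assumes c: "0 \<le> c" "c < DIM('a)" and s: "0 < s"
  shows "(\<integral>\<^sup>+y\<in>ball (0::'a::euclidean_space) s. ennreal (norm y powr - c) \<partial>lebesgue)
    \<le> ennreal (unit_ball_vol DIM('a) * (2 powr c / (1 - 2 powr (c - DIM('a)))) * s powr (DIM('a) - c))"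
proof -
  let ?n = "DIM('a)"
  define V where "V = unit_ball_vol ?n"
  have V: "0 < V" by (simp add: V_def)
  define f where "f k y = ennreal ((2 powr - (real k + 1) * s) powr - c) * indicator (cball 0 (2 powr - real k * s)) y"
    for k and y :: 'a
  have [measurable]: "f k \<in> borel_measurable lebesgue" for k
    unfolding f_def by (intro borel_measurable_times_ennreal borel_measurable_const borel_measurable_indicator) auto
  have "(\<integral>\<^sup>+y\<in>ball (0::'a) s. ennreal (norm y powr - c) \<partial>lebesgue) \<le> (\<integral>\<^sup>+y. (\<Sum>k. f k y) \<partial>lebesgue)"
  proof (rule nn_integral_mono)
    fix y :: 'a
    show "ennreal (norm y powr - c) * indicator (ball 0 s) y \<le> (\<Sum>k. f k y)"
    \<comment> \<open>The origin needs no dyadic index: \<open>0 powr - c\<close> is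
      \<open>0\<close> by convention.\<close>
    proof (cases "y \<noteq> 0 \<and> norm y < s")
      case True
      then have y: "0 < norm y" by simp
      have "1 \<le> s / norm y" using True by simp
      then obtain k :: nat where k: "2 powr real k \<le> s / norm y" "s / norm y < 2 powr (real k + 1)"
        by (rule ex_powr_2_between)
      have k1: "norm y \<le> 2 powr - real k * s"
        using k(1) y by (simp add: powr_minus field_simps)
      have k2: "2 powr - (real k + 1) * s \<le> norm y"
      proof -
        have "s < 2 powr (real k + 1) * norm y" using k(2) y by (simp add: field_simps)
        then have "2 powr - (real k + 1) * s \<le> 2 powr - (real k + 1) * (2 powr (real k + 1) * norm y)"
          by (intro mult_left_mono) auto
        also have "\<dots> = norm y"
          by (simp add: powr_add[symmetric] flip: mult.assoc)
        finally show ?thesis .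
      qed
      have "ennreal (norm y powr - c) \<le> ennreal ((2 powr - (real k + 1) * s) powr - c)"
        using k2 s c by (intro ennreal_leI powr_mono2') auto
      then have "ennreal (norm y powr - c) * indicator (ball 0 s) y \<le> f k y"
        using True k1 by (auto simp: f_def indicator_def)
      also have "f k y \<le> (\<Sum>k. f k y)"
        using sum_le_suminf[of "\<lambda>k. f k y" "{k}"] by (simp add: summableI)
      finally show ?thesis .
    qed auto
  qed
  also have "\<dots> = (\<Sum>k. \<integral>\<^sup>+y. f k y \<partial>lebesgue)"
    by (rule nn_integral_suminf) auto
  also have "\<dots> = (\<Sum>k. ennreal (V * 2 powr c * s powr (?n - c) * (2 powr (c - ?n)) ^ k))"
  proof (rule suminf_cong)
    fix k
    have "(\<integral>\<^sup>+y. f k y \<partial>lebesgue)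
        = ennreal ((2 powr - (real k + 1) * s) powr - c) * ennreal (V * (2 powr - real k * s) ^ ?n)"
      unfolding f_def using s by (subst nn_integral_cmult_indicator) (auto simp: emeasure_cball V_def)
    also have "\<dots> = ennreal ((2 powr - (real k + 1) * s) powr - c * (V * (2 powr - real k * s) ^ ?n))"
      using V s by (intro ennreal_mult[symmetric]) auto
    also have "(2 powr - (real k + 1) * s) powr - c * (V * (2 powr - real k * s) ^ ?n)
        = V * 2 powr c * s powr (?n - c) * (2 powr (c - ?n)) ^ k"
    proof -
      have "(2 powr (c - ?n)) ^ k = 2 powr (real k * (c - ?n))"
        by (simp add: powr_powr mult.commute flip: powr_realpow)
      also have "real k * (c - ?n) = real k * c + - (real k * ?n)"
        by (simp add: algebra_simps)
      finally have e1: "(2 powr (c - ?n)) ^ k = 2 powr (real k * c) * 2 powr (- (real k * ?n))"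
        by (simp only: powr_add)
      have e2: "s powr (?n - c) = s powr ?n * s powr - c"
        using powr_add[of s ?n "- c"] by simp
      have "- (real k + 1) * - c = real k * c + c" by (simp add: algebra_simps)
      then have e3: "(2 powr - (real k + 1) * s) powr - c = 2 powr (real k * c) * 2 powr c * s powr - c"
        using s by (simp only: powr_mult powr_powr powr_add mult_1)
      have "(2 powr - real k * s) ^ ?n = (2 powr - real k * s) powr ?n"
        using s by (subst powr_realpow) auto
      then have e4: "(2 powr - real k * s) ^ ?n = 2 powr (- (real k * ?n)) * s powr ?n"
        using s by (simp add: powr_mult powr_powr)
      show ?thesis unfolding e1 e2 e3 e4 by (simp only: mult_ac)
    qed
    finally show "(\<integral>\<^sup>+y. f k y \<partial>lebesgue) = ennreal (V * 2 powr c * s powr (?n - c) * (2 powr (c - ?n)) ^ k)" .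
  qed
  also have "\<dots> = ennreal (V * 2 powr c * s powr (?n - c) / (1 - 2 powr (c - ?n)))"
    using c V by (intro suminf_ennreal_geometric) (auto simp: powr_less_one)
  finally show ?thesis by (simp add: mult_ac V_def)
qed

subsection \<open>The maximal function on balls\<close>

definition maximal_function :: "('a::euclidean_space \<Rightarrow> real) \<Rightarrow> 'a \<Rightarrow> ennreal" where
  "maximal_function u x = (SUP t\<in>{0<..}.
     (\<integral>\<^sup>+y\<in>ball x t. ennreal (u y) \<partial>lebesgue) / emeasure lebesgue (ball x t))"

text \<open>By \<open>far\<close>, a ball with average above \<open>a \<ge> D\<close> has radius at
  most \<open>r\<close>; around a point of \<open>ball x r\<close> it then lies in
  \<open>ball x (2 * r)\<close>, so cutting \<open>u\<close> off there does not alter its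
  average.\<close>

lemma less_maximal_function_localE:
  fixes u :: "'a::euclidean_space \<Rightarrow> real"
  assumes a: "ennreal a < maximal_function u y" "D \<le> a" and y: "y \<in> ball x r"
    and far: "\<And>t. r < t \<Longrightarrow> (\<integral>\<^sup>+z\<in>ball y t. ennreal (u z) \<partial>lebesgue) \<le> ennreal D * emeasure lebesgue (ball y t)"
  obtains t where "0 < t"
    "ennreal a * emeasure lebesgue (ball y t)
      \<le> (\<integral>\<^sup>+z\<in>ball y t. ennreal (u z * indicator (ball x (2 * r)) z) \<partial>lebesgue)"
proof -
  let ?I = "\<lambda>t. \<integral>\<^sup>+z\<in>ball y t. ennreal (u z) \<partial>lebesgue"
  obtain t where t: "0 < t" "ennreal a < ?I t / emeasure lebesgue (ball y t)"
    using a(1) unfolding maximal_function_def less_SUP_iff by auto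
  have pos: "0 < emeasure lebesgue (ball y t)"
    using t(1) by (simp add: emeasure_ball)
  have *: "\<not> ?I t \<le> ennreal a * emeasure lebesgue (ball y t)"
    using leD[OF divide_le_posI_ennreal[OF pos, of "?I t" "ennreal a"]] t(2) by (auto simp only: mult.commute)
  have "t \<le> r"
  proof (rule ccontr)
    assume "\<not> t \<le> r"
    then have "?I t \<le> ennreal D * emeasure lebesgue (ball y t)" using far by simp
    also have "\<dots> \<le> ennreal a * emeasure lebesgue (ball y t)"
      using a(2) by (intro mult_right_mono ennreal_leI) auto
    finally show False using * by simp
  qed
  then have "ball y t \<subseteq> ball x (2 * r)"
    using y by (auto intro: dist_triangle_lt[of x y] simp: subset_eq) (smt (verit) dist_triangle)
  then have "?I t = (\<integral>\<^sup>+z\<in>ball y t. ennreal (u z * indicator (ball x (2 * r)) z) \<partial>lebesgue)"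
    by (intro nn_integral_cong) (auto simp: indicator_def)
  then show thesis using that[OF t(1)] * by simp
qed

text \<open>The interpolation is applied to \<open>g / c\<close> cut off below \<open>D\<close>: where it exceeds \<open>D\<close>, only balls of radius
  at most \<open>r\<close> matter, so \<open>u\<close> may be restricted to the doubled ball.\<close>

lemma local_maximal_bound:
  fixes u g :: "'a::euclidean_space \<Rightarrow> real"
  assumes [measurable]: "u \<in> borel_measurable lebesgue" "g \<in> borel_measurable lebesgue"
    and u: "\<And>y. 0 \<le> u y" and g: "\<And>y. 0 \<le> g y" and c: "0 < c" and p: "1 < p" and D: "0 \<le> D"
    and E [measurable]: "E \<in> sets lebesgue"
    and dom: "\<And>y. ennreal (g y) \<le> ennreal c * maximal_function u y"
    and far: "\<And>y t. y \<in> ball x r \<inter> E \<Longrightarrow> r < t \<Longrightarrow>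
        (\<integral>\<^sup>+z\<in>ball y t. ennreal (u z) \<partial>lebesgue) \<le> ennreal D * emeasure lebesgue (ball y t)"
  shows "(\<integral>\<^sup>+y\<in>ball x r \<inter> E. ennreal (g y powr p) \<partial>lebesgue)
    \<le> ennreal (c powr p) * (ennreal (2 * 5 ^ DIM('a) * (p * 2 powr (p - 1) / (p - 1)))
          * (\<integral>\<^sup>+y\<in>ball x (2 * r). ennreal (u y powr p) \<partial>lebesgue)
        + ennreal (D powr p) * emeasure lebesgue (ball x r))"
proof -
  let ?S = "ball x r \<inter> E"
  have S [measurable]: "?S \<in> sets lebesgue" by simp
  define h where "h y = (if c * D < g y then g y / c else 0) * indicator ?S y" for y
  define v where "v z = u z * indicator (ball x (2 * r)) z" for z
  have [measurable]: "h \<in> borel_measurable lebesgue" "v \<in> borel_measurable lebesgue"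
    unfolding h_def v_def by measurable
  have h0: "0 \<le> h y" and v0: "0 \<le> v y" for y
    using g[of y] u[of y] c by (auto simp: h_def v_def)
  have weak: "ennreal a * emeasure lebesgue {y \<in> space lebesgue. a < h y}
      \<le> ennreal (2 * 5 ^ DIM('a)) * (\<integral>\<^sup>+y. ennreal (v y) * indicator {y. a / 2 < v y} y \<partial>lebesgue)"
    if a: "0 < a" for a
  proof -
    have "ennreal (a / 2) * emeasure lebesgue {y \<in> space lebesgue. a < h y}
      \<le> 5 ^ DIM('a) * (\<integral>\<^sup>+y. ennreal (v y) * indicator {y. a / 2 < v y} y \<partial>lebesgue)"
    proof (rule weak_type_maximal)
      fix y assume "y \<in> {y \<in> space lebesgue. a < h y}"
      then have "a < h y" by simp
      then have y: "y \<in> ?S" "c * D < g y" "a < g y / c"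
        using a by (cases "y \<in> ?S"; auto simp: h_def split: if_splits)+
      \<comment> \<open>The height at which a ball is extracted must be at least \<open>D\<close>,
        whereas \<open>a\<close> may be smaller; the definition of \<open>h\<close> supplies
        \<open>c * D < g y\<close> together with \<open>a < g y / c\<close>.\<close>
      have "c * max a D < g y"
        using y c by (auto simp: max_def field_simps)
      have "ennreal (max a D) < maximal_function u y"
      proof (rule ccontr)
        assume "\<not> ?thesis"
        then have "ennreal (g y) \<le> ennreal c * ennreal (max a D)"
          using dom[of y] mult_left_mono[of "maximal_function u y" "ennreal (max a D)" "ennreal c"]
          by (simp add: not_less)
        also have "\<dots> = ennreal (c * max a D)"
          using c a by (intro ennreal_mult[symmetric]) auto
        finally show False
          using \<open>c * max a D < g y\<close> c a by (subst (asm) ennreal_le_iff) (auto simp: max_def)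
      qed
      then obtain t where t: "0 < t"
        "ennreal (max a D) * emeasure lebesgue (ball y t) \<le> (\<integral>\<^sup>+z\<in>ball y t. ennreal (v z) \<partial>lebesgue)"
        unfolding v_def using y far by (elim less_maximal_function_localE[where D=D and x=x and r=r]) auto
      let ?B = "unit_ball_vol DIM('a) * t ^ DIM('a)"
      have B: "emeasure lebesgue (ball y t) = ennreal ?B" "0 < ?B"
        using t(1) by (auto simp: emeasure_ball)
      have "ennreal (a / 2 * ?B) + ennreal (a / 2 * ?B) = ennreal a * emeasure lebesgue (ball y t)"
        unfolding B(1) using a B(2) by (simp flip: ennreal_mult ennreal_plus)
      also have "\<dots> \<le> ennreal (max a D) * emeasure lebesgue (ball y t)"
        by (intro mult_right_mono ennreal_leI) auto
      also have "\<dots> \<le> (\<integral>\<^sup>+z\<in>ball y t. ennreal (v z) \<partial>lebesgue)" by (rule t(2))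
      \<comment> \<open>With \<chi> the indicator of \<open>v > a / 2\<close>, the splitting
        \<open>v \<le> a / 2 + v \<chi>\<close> and cancellation of \<open>a / 2\<close> times the
        volume leave half of the average on the large values. This is the cut-off demanded by the
        interpolation, and the source of the factor \<open>2\<close> in front of
        \<open>5 ^ DIM('a)\<close>.\<close>
      also have "\<dots> \<le> (\<integral>\<^sup>+z. ennreal (a / 2) * indicator (ball y t) z
          + ennreal (v z) * indicator {y. a / 2 < v y} z * indicator (ball y t) z \<partial>lebesgue)"
        by (intro nn_integral_mono) (auto simp: indicator_def intro!: ennreal_leI)
      also have "\<dots> = ennreal (a / 2 * ?B)
          + (\<integral>\<^sup>+z\<in>ball y t. ennreal (v z) * indicator {y. a / 2 < v y} z \<partial>lebesgue)"
        using a B(2) by (subst nn_integral_add) (auto simp: nn_integral_cmult_indicator B(1) simp flip: ennreal_mult)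
      finally have "ennreal (a / 2 * ?B) \<le> (\<integral>\<^sup>+z\<in>ball y t. ennreal (v z) * indicator {y. a / 2 < v y} z \<partial>lebesgue)"
        by (subst (asm) ennreal_add_left_cancel_le) auto
      moreover have "ennreal (a / 2 * ?B) = ennreal (a / 2) * emeasure lebesgue (ball y t)"
        unfolding B(1) using a B(2) by (intro ennreal_mult) auto
      ultimately show "\<exists>t>0. ennreal (a / 2) * emeasure lebesgue (ball y t)
          \<le> (\<integral>\<^sup>+z\<in>ball y t. ennreal (v z) * indicator {y. a / 2 < v y} z \<partial>lebesgue)"
        using t(1) by (intro exI[of _ t]) simp
    qed (use a in \<open>measurable, simp\<close>)
    then have "2 * (ennreal (a / 2) * emeasure lebesgue {y \<in> space lebesgue. a < h y})
      \<le> 2 * (5 ^ DIM('a) * (\<integral>\<^sup>+y. ennreal (v y) * indicator {y. a / 2 < v y} y \<partial>lebesgue))"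
      by (rule mult_left_mono) simp
    also have "2 * (ennreal (a / 2) * emeasure lebesgue {y \<in> space lebesgue. a < h y})
      = ennreal a * emeasure lebesgue {y \<in> space lebesgue. a < h y}"
    proof -
      have "2 * ennreal (a / 2) = ennreal a"
        using a ennreal_mult[of 2 "a / 2"] by simp
      then show ?thesis by (simp flip: mult.assoc)
    qed
    also have "2 * (5 ^ DIM('a) * (\<integral>\<^sup>+y. ennreal (v y) * indicator {y. a / 2 < v y} y \<partial>lebesgue))
      = ennreal (2 * 5 ^ DIM('a)) * (\<integral>\<^sup>+y. ennreal (v y) * indicator {y. a / 2 < v y} y \<partial>lebesgue)"
      by (simp add: ennreal_mult mult.assoc flip: ennreal_power)
    finally show ?thesis .
  qed
  have "(\<integral>\<^sup>+y\<in>?S. ennreal (g y powr p) \<partial>lebesgue)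
    \<le> (\<integral>\<^sup>+y. ennreal (c powr p) * (ennreal (h y powr p) + ennreal (D powr p) * indicator (ball x r) y) \<partial>lebesgue)"
  proof (rule nn_integral_mono)
    fix y
    show "ennreal (g y powr p) * indicator ?S y
        \<le> ennreal (c powr p) * (ennreal (h y powr p) + ennreal (D powr p) * indicator (ball x r) y)"
    proof (cases "y \<in> ?S")
      case True
      have "g y powr p \<le> c powr p * (h y powr p + D powr p)"
      proof (cases "c * D < g y")
        case True
        then have "g y = c * h y" using \<open>y \<in> ?S\<close> c by (simp add: h_def)
        then have "g y powr p = c powr p * h y powr p"
          using c h0[of y] by (simp add: powr_mult)
        also have "\<dots> \<le> c powr p * (h y powr p + D powr p)" by (intro mult_left_mono) auto
        finally show ?thesis .
      next
        case False
        then have "g y powr p \<le> (c * D) powr p" using g p by (intro powr_mono2) auto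
        also have "\<dots> = c powr p * D powr p" using c D by (simp add: powr_mult)
        also have "\<dots> \<le> c powr p * (h y powr p + D powr p)" by (intro mult_left_mono) auto
        finally show ?thesis .
      qed
      then have "ennreal (g y powr p) \<le> ennreal (c powr p * (h y powr p + D powr p))"
        by (rule ennreal_leI)
      then show ?thesis using True by (simp add: ennreal_mult)
    qed auto
  qed
  also have "\<dots> = ennreal (c powr p) * ((\<integral>\<^sup>+y. ennreal (h y powr p) \<partial>lebesgue)
      + ennreal (D powr p) * emeasure lebesgue (ball x r))"
    by (simp add: nn_integral_cmult nn_integral_add)
  also have "\<dots> \<le> ennreal (c powr p) * (ennreal (2 * 5 ^ DIM('a)) * ennreal (p * 2 powr (p - 1) / (p - 1))
      * (\<integral>\<^sup>+y. ennreal (v y powr p) \<partial>lebesgue) + ennreal (D powr p) * emeasure lebesgue (ball x r))"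
    by (intro mult_left_mono add_right_mono nn_integral_powr_le_of_level_sets sigma_finite_lebesgue
        h0 v0 p weak) auto
  also have "(\<integral>\<^sup>+y. ennreal (v y powr p) \<partial>lebesgue) = (\<integral>\<^sup>+y\<in>ball x (2 * r). ennreal (u y powr p) \<partial>lebesgue)"
    by (intro nn_integral_cong) (auto simp: v_def indicator_def)
  also have "ennreal (2 * 5 ^ DIM('a)) * ennreal (p * 2 powr (p - 1) / (p - 1))
      = ennreal (2 * 5 ^ DIM('a) * (p * 2 powr (p - 1) / (p - 1)))"
    using p by (intro ennreal_mult[symmetric]) auto
  finally show ?thesis .
qed

text \<open>The height \<open>a\<close> tends to infinity in the weak-type bound while its
  right-hand side stays fixed. For \<open>a \<ge> D\<close> the balls of large average lie in
  \<open>ball x (2 * r)\<close>, so that this side is finite although \<open>u\<close> is only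
  locally integrable.\<close>

lemma null_sets_maximal_function_infinite:
  fixes u :: "'a::euclidean_space \<Rightarrow> real"
  assumes [measurable]: "u \<in> borel_measurable lebesgue"
    and E: "E \<in> sets lebesgue" "E \<subseteq> ball x r" and inf: "\<And>y. y \<in> E \<Longrightarrow> maximal_function u y = \<infinity>"
    and far: "\<And>y t. y \<in> E \<Longrightarrow> r < t \<Longrightarrow>
        (\<integral>\<^sup>+z\<in>ball y t. ennreal (u z) \<partial>lebesgue) \<le> ennreal D * emeasure lebesgue (ball y t)"
    and fin: "(\<integral>\<^sup>+z\<in>ball x (2 * r). ennreal (u z) \<partial>lebesgue) < \<infinity>"
  shows "E \<in> null_sets lebesgue"
proof -
  let ?J = "5 ^ DIM('a) * (\<integral>\<^sup>+z. ennreal (u z * indicator (ball x (2 * r)) z) \<partial>lebesgue)"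
  have bd: "ennreal a * emeasure lebesgue E \<le> ?J" if a: "max 1 D \<le> a" for a
  proof (rule weak_type_maximal)
    fix y assume y: "y \<in> E"
    have "ennreal a < maximal_function u y" using inf[OF y] by (simp add: less_top)
    then obtain t where "0 < t" "ennreal a * emeasure lebesgue (ball y t)
      \<le> (\<integral>\<^sup>+z\<in>ball y t. ennreal (u z * indicator (ball x (2 * r)) z) \<partial>lebesgue)"
      using a far[OF y] y E(2) by (elim less_maximal_function_localE[where D=D and x=x and r=r]) auto
    then show "\<exists>t>0. ennreal a * emeasure lebesgue (ball y t)
      \<le> (\<integral>\<^sup>+z\<in>ball y t. ennreal (u z * indicator (ball x (2 * r)) z) \<partial>lebesgue)" by blast
  qed (use a E in auto)
  have "(\<integral>\<^sup>+z. ennreal (u z * indicator (ball x (2 * r)) z) \<partial>lebesgue)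
      = (\<integral>\<^sup>+z\<in>ball x (2 * r). ennreal (u z) \<partial>lebesgue)"
    by (intro nn_integral_cong) (auto simp: indicator_def)
  then have "?J < \<infinity>" using fin by (simp add: ennreal_mult_less_top power_less_top_ennreal)
  then obtain J where J: "?J = ennreal J" "0 \<le> J" by (cases ?J) auto
  have "emeasure lebesgue E = 0"
  proof (cases "emeasure lebesgue E")
    case (real m)
    have "m \<le> 0"
    proof (rule ccontr)
      assume "\<not> m \<le> 0"
      define a where "a = max (max 1 D) ((J + 1) / m)"
      have "ennreal (a * m) \<le> ennreal J"
        using bd[of a] real J by (simp add: a_def ennreal_mult')
      moreover have "J + 1 \<le> a * m"
        using \<open>\<not> m \<le> 0\<close> by (simp add: a_def flip: pos_divide_le_eq)
      ultimately show False using J by simp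
    qed
    with real show ?thesis by simp
  next
    case top
    moreover have "max 1 D \<noteq> 0" by linarith
    ultimately show ?thesis using bd[of "max 1 D"] J by (simp add: ennreal_mult_top top_unique)
  qed
  with E(1) show ?thesis by blast
qed

text \<open>Hoelder's inequality with the indicator of the ball as weight; the factor
  \<open>2\<close> is that of its non-sharp form. \<open>B powr p\<close> bounds the average of
  \<open>u powr p\<close>, with the volume of the ball written out.\<close>

lemma nn_integral_ball_average_le:
  fixes u :: "'a::euclidean_space \<Rightarrow> real"
  assumes [measurable]: "u \<in> borel_measurable lebesgue" and u: "\<And>x. 0 \<le> u x" and p: "1 < p"
    and t: "0 < t" and B: "0 < B"
    and up: "(\<integral>\<^sup>+z\<in>ball y t. ennreal (u z powr p) \<partial>lebesgue)
      \<le> ennreal (B powr p * (unit_ball_vol DIM('a) * t ^ DIM('a)))"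
  shows "(\<integral>\<^sup>+z\<in>ball y t. ennreal (u z) \<partial>lebesgue) \<le> ennreal (2 * B) * emeasure lebesgue (ball y t)"
proof -
  define m where "m = unit_ball_vol DIM('a) * t ^ DIM('a)"
  have m: "0 < m" using t by (simp add: m_def)
  have em: "emeasure lebesgue (ball y t) = ennreal m" using t by (simp add: m_def emeasure_ball)
  have "(\<integral>\<^sup>+z. ennreal (u z * indicator (ball y t) z) \<partial>lebesgue)
      \<le> ennreal (2 * m powr (1 - 1 / p) * (B powr p * m) powr (1 / p))"
  proof (rule nn_integral_weighted_Hoelder)
    show "(\<integral>\<^sup>+z. ennreal (indicator (ball y t) z) \<partial>lebesgue) \<le> ennreal m"
      using em by (simp add: ennreal_indicator)
    have "(\<integral>\<^sup>+z. ennreal (u z powr p * indicator (ball y t) z) \<partial>lebesgue)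
        = (\<integral>\<^sup>+z\<in>ball y t. ennreal (u z powr p) \<partial>lebesgue)"
      by (intro nn_integral_cong) (auto simp: indicator_def)
    then show "(\<integral>\<^sup>+z. ennreal (u z powr p * indicator (ball y t) z) \<partial>lebesgue) \<le> ennreal (B powr p * m)"
      using up by (simp add: m_def)
  qed (use u p m B in auto)
  also have "2 * m powr (1 - 1 / p) * (B powr p * m) powr (1 / p) = 2 * B * m"
    using m B p by (simp add: powr_mult powr_powr powr_diff)
  also have "ennreal (2 * B * m) = ennreal (2 * B) * emeasure lebesgue (ball y t)"
    using m B em by (simp add: ennreal_mult)
  also have "(\<integral>\<^sup>+z. ennreal (u z * indicator (ball y t) z) \<partial>lebesgue) = (\<integral>\<^sup>+z\<in>ball y t. ennreal (u z) \<partial>lebesgue)"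
    by (intro nn_integral_cong) (auto simp: indicator_def)
  finally show ?thesis .
qed

subsection \<open>Morrey bounds by the maximal function\<close>

text \<open>The form with \<open>p\<close>-th powers avoids the supremum, the root and the
  integrability requirement of the Morrey norm; for \<open>A > 0\<close> it says that this norm is
  at most \<open>A\<close>.\<close>

definition morrey_bounded :: "real \<Rightarrow> real \<Rightarrow> real \<Rightarrow> ('a::euclidean_space \<Rightarrow> real) \<Rightarrow> bool" where
  "morrey_bounded p l A u \<longleftrightarrow> (\<forall>x r. 0 < r \<longrightarrow>
     (\<integral>\<^sup>+y\<in>ball x r. ennreal (u y powr p) \<partial>lebesgue) \<le> ennreal (A powr p * r powr l))"

text \<open>One \<open>N\<close> for each \<epsilon> replaces the limit, because the integrals
  decrease as \<open>N\<close> grows.\<close>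

definition uniformly_vanishing :: "real \<Rightarrow> ('a::euclidean_space \<Rightarrow> real) \<Rightarrow> bool" where
  "uniformly_vanishing p u \<longleftrightarrow> (\<forall>\<epsilon>>0. \<exists>N::nat. \<forall>x.
     (\<integral>\<^sup>+y\<in>ball x 1 \<inter> {y. real N \<le> norm y}. ennreal (u y powr p) \<partial>lebesgue) \<le> ennreal \<epsilon>)"

lemma sets_lebesgue_norm_ge [measurable]: "{y::'a::euclidean_space. a \<le> norm y} \<in> sets lebesgue"
  "{y::'a. a < norm y} \<in> sets lebesgue"
  by (auto intro!: borel_closed borel_open closed_Collect_le open_Collect_less continuous_intros sets_completionI_sets)

text \<open>Since \<open>l < n\<close>, the product \<open>t powr l = t powr (l - n) * t ^ n\<close>
  is at most \<open>r powr (l - n) * t ^ n\<close> for \<open>t \<ge> r\<close>, so one constant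
  controls the averages over all radii from \<open>r\<close> on. The factor \<open>2\<close> is
  inherited from Hoelder, the power of the unit ball volume from dividing by the measure of the
  ball.\<close>

lemma morrey_average_bound:
  fixes u :: "'a::euclidean_space \<Rightarrow> real" and l :: real
  assumes [measurable]: "u \<in> borel_measurable lebesgue" and u: "\<And>x. 0 \<le> u x" and p: "1 < p"
    and l: "l < DIM('a)" and A: "0 < A" and M: "morrey_bounded p l A u" and r: "0 < r" "r \<le> t"
  shows "(\<integral>\<^sup>+z\<in>ball y t. ennreal (u z) \<partial>lebesgue)
    \<le> ennreal (2 * (A * unit_ball_vol DIM('a) powr (- 1 / p) * r powr ((l - DIM('a)) / p)))
      * emeasure lebesgue (ball y t)"
proof (rule nn_integral_ball_average_le[OF _ u p])
  let ?n = "DIM('a)"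
  define V where "V = unit_ball_vol ?n"
  have V: "0 < V" by (simp add: V_def)
  have e: "(A * V powr (- 1 / p) * r powr ((l - ?n) / p)) powr p = A powr p * V powr - 1 * r powr (l - ?n)"
    using A V r p by (simp add: powr_mult powr_powr)
  have "t powr l = t powr (l - ?n) * t ^ ?n"
    using r by (simp add: powr_diff powr_realpow)
  also have "\<dots> \<le> r powr (l - ?n) * t ^ ?n"
    using r l by (intro mult_right_mono powr_mono2') auto
  finally have "A powr p * t powr l \<le> A powr p * (r powr (l - ?n) * t ^ ?n)"
    by (intro mult_left_mono) auto
  also have "\<dots> = (A * V powr (- 1 / p) * r powr ((l - ?n) / p)) powr p * (V * t ^ ?n)"
    unfolding e using V by (simp add: powr_minus field_simps)
  finally have "ennreal (A powr p * t powr l)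
      \<le> ennreal ((A * V powr (- 1 / p) * r powr ((l - ?n) / p)) powr p * (V * t ^ ?n))"
    by (rule ennreal_leI)
  moreover have "(\<integral>\<^sup>+z\<in>ball y t. ennreal (u z powr p) \<partial>lebesgue) \<le> ennreal (A powr p * t powr l)"
    using M r by (simp add: morrey_bounded_def)
  ultimately show "(\<integral>\<^sup>+z\<in>ball y t. ennreal (u z powr p) \<partial>lebesgue)
      \<le> ennreal ((A * unit_ball_vol ?n powr (- 1 / p) * r powr ((l - ?n) / p)) powr p * (unit_ball_vol ?n * t ^ ?n))"
    unfolding V_def by (rule order_trans[rotated])
  show "0 < A * unit_ball_vol ?n powr (- 1 / p) * r powr ((l - ?n) / p)"
    using A V r by (simp add: V_def[symmetric])
qed (use r in auto)

text \<open>The constant has two sources: the interpolation constant times \<open>2 powr l\<close>,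
  from the Morrey bound on the doubled ball, and \<open>2 powr p\<close>, from the large radii,
  whose average bound \<open>D\<close> satisfies \<open>D^p |B(x,r)| = (2 A)^p r^l\<close>.\<close>

lemma morrey_bounded_maximal:
  fixes u g :: "'a::euclidean_space \<Rightarrow> real" and l :: real
  assumes [measurable]: "u \<in> borel_measurable lebesgue" "g \<in> borel_measurable lebesgue"
    and u: "\<And>x. 0 \<le> u x" and g: "\<And>x. 0 \<le> g x" and p: "1 < p" and l: "0 \<le> l" "l < DIM('a)"
    and c: "0 < c" and A: "0 < A" and M: "morrey_bounded p l A u"
    and dom: "\<And>y. ennreal (g y) \<le> ennreal c * maximal_function u y"
  shows "morrey_bounded p l
    (c * (2 * 5 ^ DIM('a) * (p * 2 powr (p - 1) / (p - 1)) * 2 powr l + 2 powr p) powr (1 / p) * A) g"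
  unfolding morrey_bounded_def
proof (intro allI impI)
  fix x :: 'a and r :: real assume r: "0 < r"
  let ?n = "DIM('a)"
  define V where "V = unit_ball_vol ?n"
  have V: "0 < V" by (simp add: V_def)
  define K where "K = 2 * 5 ^ ?n * (p * 2 powr (p - 1) / (p - 1))"
  have K: "0 < K" using p by (simp add: K_def)
  define D where "D = 2 * (A * V powr (- 1 / p) * r powr ((l - ?n) / p))"
  have D: "0 \<le> D" using A by (simp add: D_def)
  have "D powr p = 2 powr p * A powr p * V powr - 1 * r powr (l - ?n)"
    using r V A p by (simp add: D_def powr_mult powr_powr)
  moreover have "r powr l = r powr (l - ?n) * r ^ ?n"
    using r by (simp add: powr_diff powr_realpow)
  ultimately have Dp: "D powr p * (V * r ^ ?n) = 2 powr p * A powr p * r powr l"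
    using V by (simp add: powr_minus)
  have "(\<integral>\<^sup>+y\<in>ball x r. ennreal (g y powr p) \<partial>lebesgue)
      \<le> ennreal (c powr p) * (ennreal K * (\<integral>\<^sup>+y\<in>ball x (2 * r). ennreal (u y powr p) \<partial>lebesgue)
        + ennreal (D powr p) * emeasure lebesgue (ball x r))"
    using local_maximal_bound[of u g c p D UNIV x r] u g c p D dom
      morrey_average_bound[OF _ u p l(2) A M r] less_imp_le
    by (simp add: K_def V_def D_def del: emeasure_completion)
  also have "\<dots> \<le> ennreal (c powr p) * (ennreal K * ennreal (A powr p * (2 * r) powr l)
        + ennreal (D powr p) * ennreal (V * r ^ ?n))"
    using M r by (intro mult_left_mono add_mono) (auto simp: morrey_bounded_def emeasure_ball V_def)
  also have "\<dots> = ennreal (c powr p * (K * (A powr p * (2 * r) powr l) + D powr p * (V * r ^ ?n)))"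
    using K V r by (simp add: ennreal_mult)
  also have "c powr p * (K * (A powr p * (2 * r) powr l) + D powr p * (V * r ^ ?n))
      = c powr p * (K * 2 powr l + 2 powr p) * A powr p * r powr l"
    unfolding Dp using r by (simp add: powr_mult algebra_simps)
  also have "c powr p * (K * 2 powr l + 2 powr p) * A powr p
      = (c * (K * 2 powr l + 2 powr p) powr (1 / p) * A) powr p"
    using c K A p by (simp add: powr_mult powr_powr add_nonneg_nonneg)
  finally show "(\<integral>\<^sup>+y\<in>ball x r. ennreal (g y powr p) \<partial>lebesgue)
    \<le> ennreal ((c * (2 * 5 ^ ?n * (p * 2 powr (p - 1) / (p - 1)) * 2 powr l + 2 powr p) powr (1 / p) * A) powr p * r powr l)"
    by (simp add: K_def)
qed

lemma uniformly_vanishing_maximal: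
  fixes u g :: "'a::euclidean_space \<Rightarrow> real" and l :: real
  assumes [measurable]: "u \<in> borel_measurable lebesgue" "g \<in> borel_measurable lebesgue"
    and u: "\<And>x. 0 \<le> u x" and g: "\<And>x. 0 \<le> g x" and p: "1 < p" and l: "l < DIM('a)"
    and c: "0 < c" and A: "0 < A" and M: "morrey_bounded p l A u" and van: "uniformly_vanishing p u"
    and dom: "\<And>y. ennreal (g y) \<le> ennreal c * maximal_function u y"
  shows "uniformly_vanishing p g"
  unfolding uniformly_vanishing_def
proof (intro allI impI)
  fix \<epsilon> :: real assume \<epsilon>: "0 < \<epsilon>"
  let ?n = "DIM('a)"
  define V where "V = unit_ball_vol ?n"
  have V: "0 < V" by (simp add: V_def)
  define K where "K = 2 * 5 ^ ?n * (p * 2 powr (p - 1) / (p - 1))"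
  have K: "0 < K" using p by (simp add: K_def)
  \<comment> \<open>Chosen to absorb the final constant. There \<open>3 ^ ?n\<close> comes from
    comparing the doubled ball, of radius \<open>2\<close>, with unit balls, and
    \<open>2 ^ ?n\<close> from \<open>t + 1 \<le> 2 * t\<close> for \<open>t > 1\<close>.\<close>
  define \<delta> where "\<delta> = \<epsilon> / (c powr p * (K * 3 ^ ?n + 2 powr p * 2 ^ ?n))"
  have pos: "0 < c powr p * (K * 3 ^ ?n + 2 powr p * 2 ^ ?n)"
    using c K by (intro mult_pos_pos add_pos_pos) auto
  have \<delta>: "0 < \<delta>" using \<epsilon> pos by (simp add: \<delta>_def)
  obtain N0 :: nat where N0: "\<And>x. (\<integral>\<^sup>+y\<in>ball x 1 \<inter> {y. real N0 \<le> norm y}. ennreal (u y powr p) \<partial>lebesgue) \<le> ennreal \<delta>"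
    using van \<delta> unfolding uniformly_vanishing_def by blast
  \<comment> \<open>A ball of radius \<open>t\<close> whose centre has norm at least
    \<open>N0 + t\<close> avoids \<open>ball 0 N0\<close>, so \<open>u\<close> may be cut off there,
    after which each unit ball carries mass at most \<delta>.\<close>
  have big: "(\<integral>\<^sup>+z\<in>ball y t. ennreal (u z powr p) \<partial>lebesgue) \<le> ennreal ((t + 1) ^ ?n * \<delta>)"
    if t: "0 < t" "real N0 + t \<le> norm y" for y t
  proof -
    have out: "real N0 \<le> norm z" if "z \<in> ball y t" for z
      using that t norm_triangle_ineq2[of y z] by (auto simp: dist_norm)
    have "(\<integral>\<^sup>+z\<in>ball y t. ennreal (u z powr p) \<partial>lebesgue)
        = (\<integral>\<^sup>+z\<in>ball y t. ennreal (u z powr p) * indicator {y. real N0 \<le> norm y} z \<partial>lebesgue)"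
      using out by (intro nn_integral_cong) (auto simp: indicator_def)
    also have "\<dots> \<le> ennreal ((t + 1) ^ ?n) * ennreal \<delta>"
    proof (rule nn_integral_ball_le_of_unit_balls)
      fix z
      show "(\<integral>\<^sup>+w\<in>ball z 1. ennreal (u w powr p) * indicator {y. real N0 \<le> norm y} w \<partial>lebesgue) \<le> ennreal \<delta>"
        using N0[of z] by (simp add: indicator_inter_arith mult_ac)
    qed (use t in auto)
    also have "\<dots> = ennreal ((t + 1) ^ ?n * \<delta>)"
      using t \<delta> by (intro ennreal_mult[symmetric]) auto
    finally show ?thesis .
  qed
  \<comment> \<open>\<open>big\<close> bounds the averages of \<open>u powr p\<close> over radii
    \<open>t > 1\<close> by \<open>2 ^ ?n * \<delta> / V\<close>; \<open>B\<close> is the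
    \<open>p\<close>-th root of this.\<close>
  define B where "B = (2 ^ ?n * \<delta> / V) powr (1 / p)"
  have B: "0 < B" using V \<delta> by (simp add: B_def)
  have Bp: "B powr p = 2 ^ ?n * \<delta> / V" using V \<delta> p by (simp add: B_def powr_powr)
  define Y where "Y = A * V powr (- 1 / p) / B"
  have Y: "0 < Y" using A V B by (simp add: Y_def)
  \<comment> \<open>Unless clipped at \<open>1\<close>, \<open>R\<close> is the radius at which the
    Morrey bound on averages has dropped to the level \<open>B\<close>, up to the factor
    \<open>2\<close> from Hoelder.\<close>
  define R where "R = max 1 (Y powr (p / (?n - l)))"
  have R: "1 \<le> R" "0 < Y powr (p / (?n - l))" using Y by (auto simp: R_def)
  have "R powr ((l - ?n) / p) \<le> (Y powr (p / (?n - l))) powr ((l - ?n) / p)"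
    using l p R by (intro powr_mono2') (auto simp: R_def divide_nonpos_pos)
  also have "\<dots> = inverse Y"
  proof -
    have "p / (?n - l) * ((l - ?n) / p) = - 1" using l p by (simp add: field_simps)
    then show ?thesis using Y by (simp add: powr_powr powr_minus)
  qed
  finally have "A * V powr (- 1 / p) * R powr ((l - ?n) / p) \<le> A * V powr (- 1 / p) * inverse Y"
    using A by (intro mult_left_mono) auto
  then have RB: "A * V powr (- 1 / p) * R powr ((l - ?n) / p) \<le> B"
    using A V B by (simp add: Y_def)
  have far: "(\<integral>\<^sup>+z\<in>ball y t. ennreal (u z) \<partial>lebesgue) \<le> ennreal (2 * B) * emeasure lebesgue (ball y t)"
    if y: "real N0 + R \<le> norm y" and t: "1 < t" for y t
  proof (cases "t \<le> R")
    case True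
    have "(t + 1) ^ ?n * \<delta> \<le> (2 * t) ^ ?n * \<delta>"
      using t \<delta> by (intro mult_right_mono power_mono) auto
    also have "\<dots> = B powr p * (V * t ^ ?n)"
      unfolding Bp using V by (simp add: power_mult_distrib)
    finally have "(\<integral>\<^sup>+z\<in>ball y t. ennreal (u z powr p) \<partial>lebesgue) \<le> ennreal (B powr p * (V * t ^ ?n))"
      using order_trans[OF big[of t y] ennreal_leI] y t True by auto
    then show ?thesis
      using t B by (intro nn_integral_ball_average_le[OF _ u p]) (auto simp: V_def)
  next
    case False
    then have "(\<integral>\<^sup>+z\<in>ball y t. ennreal (u z) \<partial>lebesgue)
        \<le> ennreal (2 * (A * V powr (- 1 / p) * R powr ((l - ?n) / p))) * emeasure lebesgue (ball y t)"
      unfolding V_def using R by (intro morrey_average_bound u p l A M) auto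
    also have "\<dots> \<le> ennreal (2 * B) * emeasure lebesgue (ball y t)"
      using RB by (intro mult_right_mono ennreal_leI) auto
    finally show ?thesis .
  qed
  \<comment> \<open>This meets two demands: points of the region have norm at least
    \<open>N0 + R\<close>, for \<open>far\<close>, and the centre \<open>x\<close>, of norm at least
    \<open>N - 1\<close>, has norm at least \<open>N0 + 2\<close>, for \<open>big\<close> on the
    doubled ball.\<close>
  obtain N :: nat where N: "real N0 + R + 4 \<le> real N" using real_arch_simple by blast
  show "\<exists>N::nat. \<forall>x. (\<integral>\<^sup>+y\<in>ball x 1 \<inter> {y. real N \<le> norm y}. ennreal (g y powr p) \<partial>lebesgue) \<le> ennreal \<epsilon>"
  proof (intro exI[of _ N] allI)
    fix x :: 'a
    show "(\<integral>\<^sup>+y\<in>ball x 1 \<inter> {y. real N \<le> norm y}. ennreal (g y powr p) \<partial>lebesgue) \<le> ennreal \<epsilon>"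
    proof (cases "ball x 1 \<inter> {y. real N \<le> norm y} = {}")
      case False
      then obtain y where "dist x y < 1" "real N \<le> norm y" by auto
      then have x: "real N \<le> norm x + 1"
        using norm_triangle_ineq2[of y x] by (auto simp: dist_norm norm_minus_commute)
      have "(\<integral>\<^sup>+y\<in>ball x 1 \<inter> {y. real N \<le> norm y}. ennreal (g y powr p) \<partial>lebesgue)
        \<le> ennreal (c powr p) * (ennreal K * (\<integral>\<^sup>+y\<in>ball x (2 * 1). ennreal (u y powr p) \<partial>lebesgue)
          + ennreal ((2 * B) powr p) * emeasure lebesgue (ball x 1))"
        unfolding K_def
      proof (rule local_maximal_bound)
        fix y t assume "y \<in> ball x 1 \<inter> {y. real N \<le> norm y}" "(1::real) < t"
        then show "(\<integral>\<^sup>+z\<in>ball y t. ennreal (u z) \<partial>lebesgue) \<le> ennreal (2 * B) * emeasure lebesgue (ball y t)"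
          using N by (intro far) auto
      qed (use u g c p B dom in auto)
      also have "\<dots> \<le> ennreal (c powr p) * (ennreal K * ennreal (3 ^ ?n * \<delta>) + ennreal ((2 * B) powr p) * ennreal V)"
        using big[of 2 x] x N R by (intro mult_left_mono add_mono) (auto simp: V_def emeasure_ball)
      also have "\<dots> = ennreal (c powr p * (K * (3 ^ ?n * \<delta>) + (2 * B) powr p * V))"
        using K \<delta> V by (simp add: ennreal_mult)
      also have "(2 * B) powr p * V = 2 powr p * 2 ^ ?n * \<delta>"
        using B V by (simp add: powr_mult Bp)
      also have "c powr p * (K * (3 ^ ?n * \<delta>) + 2 powr p * 2 ^ ?n * \<delta>)
          = c powr p * (K * 3 ^ ?n + 2 powr p * 2 ^ ?n) * \<delta>" by (simp add: algebra_simps)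
      also have "\<dots> = \<epsilon>" using pos unfolding \<delta>_def by (metis less_irrefl nonzero_mult_div_cancel_left times_divide_eq_right)
      finally show ?thesis .
    qed simp
  qed
qed

subsection \<open>The dual Hardy operator\<close>

lemma nn_integral_powr_ball_le:
  fixes e :: real
  assumes "0 \<le> e" "e < DIM('a::euclidean_space)"
  obtains c where "0 < c"
    "\<And>s. 0 < s \<Longrightarrow> (\<integral>\<^sup>+x\<in>ball (0::'a) s. ennreal (norm x powr - e) \<partial>lebesgue) \<le> ennreal (c * s powr (DIM('a) - e))"
proof
  show "0 < unit_ball_vol DIM('a) * (2 powr e / (1 - 2 powr (e - DIM('a))))"
    using assms by (intro mult_pos_pos divide_pos_pos) (auto simp: powr_less_one)
qed (use nn_integral_powr_ball[OF assms] in simp)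

lemma nn_integral_morrey_tail:
  fixes u :: "'a::euclidean_space \<Rightarrow> real" and b l :: real
  assumes [measurable]: "u \<in> borel_measurable lebesgue" and l: "0 \<le> l" "l < b"
    and M: "morrey_bounded p l A u" and s: "0 < s"
  shows "(\<integral>\<^sup>+y\<in>{y. s \<le> norm y}. ennreal (norm y powr - b) * ennreal (u y powr p) \<partial>lebesgue)
    \<le> ennreal (2 powr l / (1 - 2 powr (l - b)) * A powr p * s powr (l - b))"
  using nn_integral_powr_tail[of "\<lambda>y. ennreal (u y powr p)" l b "A powr p" s] M l s
  by (simp add: morrey_bounded_def mult_ac)

text \<open>The weight in Hoelder's inequality is \<open>|y|\<^sup>-\<^sup>n\<^sup>-\<^sup>b\<close> with \<open>b (p - 1) = e\<close>.\<close>

lemma hardy_dual_Hoelder: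
  fixes e p :: real
  assumes p: "1 < p" and e: "0 < e"
  obtains c where "0 < c"
    "\<And>(u :: 'a::euclidean_space \<Rightarrow> real) s K. \<lbrakk>u \<in> borel_measurable lebesgue; \<And>y. 0 \<le> u y; 0 < s; 0 \<le> K;
      ennreal K \<le> (\<integral>\<^sup>+y\<in>{y. s < norm y}. ennreal (u y / norm y ^ DIM('a)) \<partial>lebesgue)\<rbrakk> \<Longrightarrow>
      ennreal (K powr p) \<le> ennreal (c * s powr - e) *
        (\<integral>\<^sup>+y\<in>{y. s < norm y}. ennreal (norm y powr - (DIM('a) - e)) * ennreal (u y powr p) \<partial>lebesgue)"
proof -
  let ?n = "DIM('a)"
  define V where "V = unit_ball_vol ?n"
  have V: "0 < V" by (simp add: V_def)
  define b where "b = e / (p - 1)"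
  have b: "0 < b" "b * (p - 1) = e" using p e by (auto simp: b_def)
  define c0 where "c0 = V * (2 powr ?n / (1 - 2 powr - b))"
  have c0: "0 < c0" using V b by (auto simp: c0_def powr_less_one intro!: divide_pos_pos)
  show thesis
  proof (rule that[of "2 powr p * c0 powr (p - 1)"])
    fix u :: "'a \<Rightarrow> real" and s K :: real
    assume [measurable]: "u \<in> borel_measurable lebesgue" and u: "\<And>y. 0 \<le> u y" and s: "0 < s" and K: "0 \<le> K"
      and KT: "ennreal K \<le> (\<integral>\<^sup>+y\<in>{y. s < norm y}. ennreal (u y / norm y ^ ?n) \<partial>lebesgue)"
    let ?S = "{y::'a. s < norm y}"
    define w where "w y = norm y powr - (?n + b) * indicator ?S y" for y :: 'a
    note nm = borel_measurable_lebesgue_norm[where 'a="'a"]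
    have [measurable]: "w \<in> borel_measurable lebesgue" "(\<lambda>y. u y * norm y powr b) \<in> borel_measurable lebesgue"
      unfolding w_def using nm by measurable
    have w0: "0 \<le> w y" for y by (simp add: w_def)
    \<comment> \<open>A tail estimate with density \<open>1\<close>, whose mass on balls grows with
      exponent \<open>n\<close>; the surplus \<open>b\<close> in the weight makes it
      converge.\<close>
    have wm: "(\<integral>\<^sup>+y. ennreal (w y) \<partial>lebesgue) \<le> ennreal (c0 * s powr - b)"
    proof -
      have "(\<integral>\<^sup>+y. ennreal (w y) \<partial>lebesgue) \<le> (\<integral>\<^sup>+y\<in>{y::'a. s \<le> norm y}. ennreal (norm y powr - (?n + b)) * 1 \<partial>lebesgue)"
        by (intro nn_integral_mono) (auto simp: w_def indicator_def)
      also have "\<dots> \<le> ennreal (V * (2 powr ?n / (1 - 2 powr (?n - (?n + b)))) * s powr (?n - (?n + b)))"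
        using b s V
        by (intro nn_integral_powr_tail) (auto simp: emeasure_ball V_def powr_realpow)
      finally show ?thesis by (simp add: c0_def)
    qed
    have Tw: "(\<integral>\<^sup>+y\<in>?S. ennreal (u y / norm y ^ ?n) \<partial>lebesgue)
        = (\<integral>\<^sup>+y. ennreal (u y * norm y powr b * w y) \<partial>lebesgue)"
    proof (intro nn_integral_cong)
      fix y :: 'a
      show "ennreal (u y / norm y ^ ?n) * indicator ?S y = ennreal (u y * norm y powr b * w y)"
      proof (cases "y \<in> ?S")
        case True
        then have y: "0 < norm y" using s by (auto intro: less_trans)
        have "norm y powr b * norm y powr - (?n + b) = norm y powr - ?n"
          by (simp flip: powr_add)
        also have "\<dots> = 1 / norm y ^ ?n"
          using y by (simp add: powr_minus powr_realpow field_simps)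
        finally show ?thesis using True by (simp add: w_def mult.assoc)
      qed (auto simp: w_def)
    qed
    \<comment> \<open>Hoelder for \<open>u |y|^b\<close> against \<open>w\<close>. The mass of the
      weight contributes \<open>(s^(-b))^(p-1) = s^(-e)\<close>, and under the integral the
      exponents combine to \<open>b p - n - b = e - n\<close>.\<close>
    have "ennreal (K powr p) \<le> ennreal (2 powr p * (c0 * s powr - b) powr (p - 1)) *
        (\<integral>\<^sup>+y. ennreal ((u y * norm y powr b) powr p * w y) \<partial>lebesgue)"
      using c0 s u KT K wm unfolding Tw
      by (intro nn_integral_weighted_Hoelder_powr p w0) auto
    also have "(c0 * s powr - b) powr (p - 1) = c0 powr (p - 1) * s powr - e"
      using c0 s b by (simp add: powr_mult powr_powr)
    also have "(\<integral>\<^sup>+y. ennreal ((u y * norm y powr b) powr p * w y) \<partial>lebesgue)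
      = (\<integral>\<^sup>+y\<in>?S. ennreal (norm y powr - (?n - e)) * ennreal (u y powr p) \<partial>lebesgue)"
    proof (intro nn_integral_cong)
      fix y :: 'a
      have "b * p + - (?n + b) = - (?n - e)" using b by (simp add: algebra_simps)
      then have "(norm y powr b) powr p * norm y powr - (?n + b) = norm y powr - (?n - e)"
        by (simp only: powr_powr flip: powr_add)
      then have "(u y * norm y powr b) powr p * norm y powr - (?n + b) = norm y powr - (?n - e) * u y powr p"
        using u[of y] by (simp add: powr_mult mult.assoc mult.commute[of "u y powr p"])
      then show "ennreal ((u y * norm y powr b) powr p * w y)
        = ennreal (norm y powr - (?n - e)) * ennreal (u y powr p) * indicator ?S y"
        by (cases "y \<in> ?S") (auto simp: w_def simp flip: ennreal_mult)
    qed
    finally show "ennreal (K powr p) \<le> ennreal (2 powr p * c0 powr (p - 1) * s powr - e) *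
        (\<integral>\<^sup>+y\<in>?S. ennreal (norm y powr - (?n - e)) * ennreal (u y powr p) \<partial>lebesgue)"
      by (simp add: mult.assoc)
  qed (use c0 in auto)
qed

text \<open>After the exchange, the inner integral of \<open>|x|^(-e)\<close> runs over
  \<open>|x| < min(r, |y|)\<close> and is at most a multiple of this minimum to the power
  \<open>n - e\<close>. For \<open>|y| < r\<close> that cancels the weight in \<open>y\<close> and
  leaves the Morrey integral over the ball, the summand \<open>1\<close> of the constant; for
  \<open>|y| \<ge> r\<close> it leaves the tail estimate, the other summand.\<close>

lemma hardy_dual_bound_at_centre:
  fixes u :: "'a::euclidean_space \<Rightarrow> real" and e p l :: real
  assumes [measurable]: "u \<in> borel_measurable lebesgue"
    and l: "0 \<le> l" "l < DIM('a) - e" "0 \<le> e"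
    and c: "0 \<le> c" "\<And>s. 0 < s \<Longrightarrow> (\<integral>\<^sup>+x\<in>ball (0::'a) s. ennreal (norm x powr - e) \<partial>lebesgue)
      \<le> ennreal (c * s powr (DIM('a) - e))"
    and M: "morrey_bounded p l A u" and r: "0 < r"
  shows "(\<integral>\<^sup>+x\<in>ball (0::'a) r. ennreal (norm x powr - e) *
      (\<integral>\<^sup>+y\<in>{y. norm x < norm y}. ennreal (norm y powr - (DIM('a) - e)) * ennreal (u y powr p) \<partial>lebesgue) \<partial>lebesgue)
    \<le> ennreal (c * (1 + 2 powr l / (1 - 2 powr (l - (DIM('a) - e)))) * A powr p * r powr l)"
proof -
  let ?n = "DIM('a)"
  define c1 where "c1 = 2 powr l / (1 - 2 powr (l - (?n - e)))"
  have c1: "0 \<le> c1" using l by (auto simp: c1_def powr_less_one intro!: divide_nonneg_pos)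
  interpret L: sigma_finite_measure "lebesgue :: 'a measure" by (rule sigma_finite_lebesgue)
  interpret P: pair_sigma_finite "lebesgue :: 'a measure" "lebesgue :: 'a measure" ..
  define f where "f x y = (ennreal (norm x powr - e) * indicator (ball 0 r) x)
      * (ennreal (norm y powr - (?n - e)) * ennreal (u y powr p)) * indicator {y. norm x < norm y} y" for x y :: 'a
  note nm [measurable] = borel_measurable_lebesgue_norm[where 'a="'a"]
  have [measurable]: "(\<lambda>q. norm (fst q)) \<in> borel_measurable (lebesgue \<Otimes>\<^sub>M lebesgue :: ('a \<times> 'a) measure)"
    "(\<lambda>q. norm (snd q)) \<in> borel_measurable (lebesgue \<Otimes>\<^sub>M lebesgue :: ('a \<times> 'a) measure)"
    using measurable_compose[OF measurable_fst nm] measurable_compose[OF measurable_snd nm] by auto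
  have fm: "case_prod f \<in> borel_measurable (lebesgue \<Otimes>\<^sub>M lebesgue)"
    unfolding f_def case_prod_beta' indicator_def mem_ball mem_Collect_eq dist_0_norm by measurable
  have "(\<integral>\<^sup>+x\<in>ball (0::'a) r. ennreal (norm x powr - e) *
      (\<integral>\<^sup>+y\<in>{y. norm x < norm y}. ennreal (norm y powr - (?n - e)) * ennreal (u y powr p) \<partial>lebesgue) \<partial>lebesgue)
    = (\<integral>\<^sup>+x. (\<integral>\<^sup>+y. f x y \<partial>lebesgue) \<partial>lebesgue)"
  proof (rule nn_integral_cong)
    fix x :: 'a
    have "(\<integral>\<^sup>+y. f x y \<partial>lebesgue) = (ennreal (norm x powr - e) * indicator (ball 0 r) x) *
        (\<integral>\<^sup>+y\<in>{y. norm x < norm y}. ennreal (norm y powr - (?n - e)) * ennreal (u y powr p) \<partial>lebesgue)"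
      unfolding f_def by (subst nn_integral_cmult[symmetric]) (auto simp: mult.assoc)
    then show "ennreal (norm x powr - e) *
      (\<integral>\<^sup>+y\<in>{y. norm x < norm y}. ennreal (norm y powr - (?n - e)) * ennreal (u y powr p) \<partial>lebesgue) * indicator (ball 0 r) x
      = (\<integral>\<^sup>+y. f x y \<partial>lebesgue)" by (simp add: mult_ac)
  qed
  also have "\<dots> = (\<integral>\<^sup>+y. (\<integral>\<^sup>+x. f x y \<partial>lebesgue) \<partial>lebesgue)"
    by (rule P.Fubini'[OF fm, symmetric])
  also have "\<dots> \<le> (\<integral>\<^sup>+y. ennreal c * (ennreal (u y powr p) * indicator (ball 0 r) y)
      + ennreal (c * r powr (?n - e)) * (ennreal (norm y powr - (?n - e)) * ennreal (u y powr p) * indicator {y. r \<le> norm y} y) \<partial>lebesgue)"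
  proof (rule nn_integral_mono)
    fix y :: 'a
    let ?W = "ennreal (norm y powr - (?n - e)) * ennreal (u y powr p)"
    have inner: "(\<integral>\<^sup>+x. f x y \<partial>lebesgue) \<le> ?W * ennreal (c * s powr (?n - e))"
      if s: "0 < s" "s = min r (norm y)" for s
    proof -
      have "(\<integral>\<^sup>+x. f x y \<partial>lebesgue) = (\<integral>\<^sup>+x. ?W * (ennreal (norm x powr - e) * indicator (ball (0::'a) s) x) \<partial>lebesgue)"
        unfolding f_def using s by (intro nn_integral_cong) (auto simp: indicator_def mult_ac)
      also have "\<dots> = ?W * (\<integral>\<^sup>+x\<in>ball (0::'a) s. ennreal (norm x powr - e) \<partial>lebesgue)"
        by (rule nn_integral_cmult) auto
      also have "\<dots> \<le> ?W * ennreal (c * s powr (?n - e))"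
        by (intro mult_left_mono c s) auto
      finally show ?thesis .
    qed
    \<comment> \<open>At \<open>y = 0\<close> the weights would not cancel, since
      \<open>0 powr a\<close> is \<open>0\<close> for every \<open>a\<close>; there the integrand
      vanishes because \<open>norm x < 0\<close> is impossible.\<close>
    consider "y = 0" | "0 < norm y" "norm y < r" | "r \<le> norm y" using zero_less_norm_iff by force
    then show "(\<integral>\<^sup>+x. f x y \<partial>lebesgue) \<le> ennreal c * (ennreal (u y powr p) * indicator (ball 0 r) y)
      + ennreal (c * r powr (?n - e)) * (?W * indicator {y. r \<le> norm y} y)"
    proof cases
      case 1
      then show ?thesis by (simp add: f_def)
    next
      case 2
      have "?W * ennreal (c * norm y powr (?n - e)) = ennreal (norm y powr - (?n - e) * u y powr p * (c * norm y powr (?n - e)))"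
        using c(1) by (simp add: ennreal_mult)
      also have "norm y powr - (?n - e) * u y powr p * (c * norm y powr (?n - e)) = c * u y powr p"
      proof -
        have "norm y powr - (?n - e) * norm y powr (?n - e) = 1"
          using 2 by (simp only: powr_add[symmetric]) simp
        then show ?thesis by (metis mult.left_commute mult.right_neutral mult.commute)
      qed
      finally show ?thesis using inner[of "norm y"] 2 c(1) by (simp add: ennreal_mult)
    next
      case 3
      then show ?thesis using inner[of r] r by (simp add: mult_ac)
    qed
  qed
  also have "\<dots> = ennreal c * (\<integral>\<^sup>+y\<in>ball 0 r. ennreal (u y powr p) \<partial>lebesgue)
      + ennreal (c * r powr (?n - e)) * (\<integral>\<^sup>+y\<in>{y. r \<le> norm y}. ennreal (norm y powr - (?n - e)) * ennreal (u y powr p) \<partial>lebesgue)"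
    by (subst nn_integral_add) (auto simp: nn_integral_cmult)
  also have "\<dots> \<le> ennreal c * ennreal (A powr p * r powr l)
      + ennreal (c * r powr (?n - e)) * ennreal (c1 * A powr p * r powr (l - (?n - e)))"
    unfolding c1_def using M r l
    by (intro add_mono mult_left_mono nn_integral_morrey_tail) (auto simp: morrey_bounded_def)
  also have "\<dots> = ennreal (c * (A powr p * r powr l) + c * r powr (?n - e) * (c1 * A powr p * r powr (l - (?n - e))))"
    using c(1) c1 by (simp add: ennreal_mult)
  also have "c * (A powr p * r powr l) + c * r powr (?n - e) * (c1 * A powr p * r powr (l - (?n - e)))
      = c * (1 + c1) * A powr p * r powr l"
  proof -
    have "r powr (?n - e) * r powr (l - (?n - e)) = r powr l" by (simp flip: powr_add)
    then have "c * r powr (?n - e) * (c1 * A powr p * r powr (l - (?n - e))) = c * c1 * A powr p * r powr l"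
      by (simp add: mult_ac)
    then show ?thesis by (simp add: algebra_simps)
  qed
  finally show ?thesis by (simp add: c1_def)
qed

text \<open>\<open>C\<close> is obtained before \<open>u\<close>, \<open>g\<close> and
  \<open>A\<close>, which is the uniformity that boundedness asks for. \<open>g\<close> stands for
  the norm of the dual Hardy transform and is tied to \<open>u\<close> only by domination off the
  origin, so no Bochner integral occurs.\<close>

lemma hardy_dual_estimates:
  fixes p l :: real
  assumes p: "1 < p" and l: "0 \<le> l" "l < DIM('a::euclidean_space)"
  obtains C where "0 < C"
    "\<And>(u :: 'a \<Rightarrow> real) A s. \<lbrakk>u \<in> borel_measurable lebesgue; \<And>y. 0 \<le> u y; 0 < A; morrey_bounded p l A u; 0 < s\<rbrakk>
      \<Longrightarrow> (\<integral>\<^sup>+y\<in>{y. s < norm y}. ennreal (u y / norm y ^ DIM('a)) \<partial>lebesgue) < \<infinity>"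
    "\<And>(u :: 'a \<Rightarrow> real) (g :: 'a \<Rightarrow> real) A. \<lbrakk>u \<in> borel_measurable lebesgue; \<And>y. 0 \<le> u y; g \<in> borel_measurable lebesgue;
      \<And>y. 0 \<le> g y; 0 < A; morrey_bounded p l A u;
      \<And>x. x \<noteq> 0 \<Longrightarrow> ennreal (g x) \<le> (\<integral>\<^sup>+y\<in>{y. norm x < norm y}. ennreal (u y / norm y ^ DIM('a)) \<partial>lebesgue)\<rbrakk>
      \<Longrightarrow> morrey_bounded p l (C * A) g \<and> uniformly_vanishing p g"
proof -
  let ?n = "DIM('a)"
  define V where "V = unit_ball_vol ?n"
  have V: "0 < V" by (simp add: V_def)
  \<comment> \<open>Half of the gap \<open>n - l\<close>: \<open>e > 0\<close> serves the Hoelder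
    weight, \<open>e < n\<close> the integrability of \<open>|x|^(-e)\<close> at the origin, and
    \<open>l < n - e\<close> the tail of the Morrey bound.\<close>
  define e where "e = (?n - l) / 2"
  have e: "0 < e" "e < ?n" "l < ?n - e" using l by (auto simp: e_def field_simps)
  let ?T = "\<lambda>(u :: 'a \<Rightarrow> real) s. \<integral>\<^sup>+y\<in>{y. s < norm y}. ennreal (u y / norm y ^ DIM('a)) \<partial>lebesgue"
  let ?I = "\<lambda>(u :: 'a \<Rightarrow> real) s. \<integral>\<^sup>+y\<in>{y. s < norm y}. ennreal (norm y powr - (?n - e)) * ennreal (u y powr p) \<partial>lebesgue"
  obtain c2 where c2: "0 < c2" and Hoelder: "\<And>(u :: 'a \<Rightarrow> real) s K. \<lbrakk>u \<in> borel_measurable lebesgue; \<And>y. 0 \<le> u y; 0 < s;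
      0 \<le> K; ennreal K \<le> ?T u s\<rbrakk> \<Longrightarrow> ennreal (K powr p) \<le> ennreal (c2 * s powr - e) * ?I u s"
    using hardy_dual_Hoelder[OF p e(1), where 'a='a] by blast
  obtain c5 where c5: "0 < c5" "\<And>s. 0 < s \<Longrightarrow> (\<integral>\<^sup>+x\<in>ball (0::'a) s. ennreal (norm x powr - e) \<partial>lebesgue)
      \<le> ennreal (c5 * s powr (?n - e))"
    using nn_integral_powr_ball_le[where 'a='a, of e] e by auto
  define c1 where "c1 = 2 powr l / (1 - 2 powr (l - (?n - e)))"
  have c1: "0 < c1" using e by (auto simp: c1_def powr_less_one intro!: divide_pos_pos)
  define c3 where "c3 = c2 * c1"
  have c3: "0 < c3" using c1 c2 by (simp add: c3_def)
  define c4 where "c4 = c5 * (1 + c1)"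
  have c4: "0 < c4" using c1 c5 by (simp add: c4_def)
  \<comment> \<open>\<open>K\<close> ranges over the reals below an integral not yet known to be
    finite; finiteness is deduced from this very bound.\<close>
  have pointwise: "K powr p \<le> c3 * A powr p * s powr (l - ?n)"
    if u: "u \<in> borel_measurable lebesgue" "\<And>y. 0 \<le> u y" and M: "morrey_bounded p l A u"
      and s: "0 < s" and K: "0 \<le> K" "ennreal K \<le> ?T u s" for u :: "'a \<Rightarrow> real" and A s K
  proof -
    have "ennreal (K powr p) \<le> ennreal (c2 * s powr - e) * ?I u s" by (rule Hoelder[OF u s K])
    also have "?I u s \<le> (\<integral>\<^sup>+y\<in>{y. s \<le> norm y}. ennreal (norm y powr - (?n - e)) * ennreal (u y powr p) \<partial>lebesgue)"
      by (intro nn_integral_mono) (auto simp: indicator_def)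
    also have "\<dots> \<le> ennreal (c1 * A powr p * s powr (l - (?n - e)))"
      unfolding c1_def by (rule nn_integral_morrey_tail[OF u(1) l(1) e(3) M s])
    finally have "ennreal (K powr p) \<le> ennreal (c2 * s powr - e) * ennreal (c1 * A powr p * s powr (l - (?n - e)))"
      by (simp add: mult_left_mono)
    also have "\<dots> = ennreal (c2 * s powr - e * (c1 * A powr p * s powr (l - (?n - e))))"
      using c1 c2 by (intro ennreal_mult[symmetric]) auto
    finally have "K powr p \<le> c2 * s powr - e * (c1 * A powr p * s powr (l - (?n - e)))"
      using c1 c2 by (subst (asm) ennreal_le_iff) auto
    also have "\<dots> = c3 * A powr p * (s powr - e * s powr (l - (?n - e)))" by (simp add: c3_def mult_ac)
    also have "s powr - e * s powr (l - (?n - e)) = s powr (l - ?n)" by (simp flip: powr_add)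
    finally show ?thesis .
  qed
  have near: "(\<integral>\<^sup>+y\<in>ball 0 r. ennreal (g y powr p) \<partial>lebesgue) \<le> ennreal (c2 * c4 * A powr p * r powr l)"
    if u: "u \<in> borel_measurable lebesgue" "\<And>y. 0 \<le> u y" and M: "morrey_bounded p l A u"
      and g: "\<And>y. 0 \<le> g y" "\<And>x. x \<noteq> 0 \<Longrightarrow> ennreal (g x) \<le> ?T u (norm x)" and r: "0 < r"
    for u g :: "'a \<Rightarrow> real" and A r
  proof -
    have "(\<integral>\<^sup>+y\<in>ball 0 r. ennreal (g y powr p) \<partial>lebesgue)
      \<le> (\<integral>\<^sup>+x. ennreal c2 * (ennreal (norm x powr - e) * ?I u (norm x) * indicator (ball (0::'a) r) x) \<partial>lebesgue)"
    proof (rule nn_integral_mono_AE)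
      have "AE x in lborel. x \<noteq> (0::'a)" by (rule AE_lborel_singleton)
      then have "AE x in lebesgue. x \<noteq> (0::'a)" by (rule AE_completion)
      then show "AE x in lebesgue. ennreal (g x powr p) * indicator (ball 0 r) x
          \<le> ennreal c2 * (ennreal (norm x powr - e) * ?I u (norm x) * indicator (ball 0 r) x)"
      proof eventually_elim
        case (elim x)
        then have "ennreal (g x powr p) \<le> ennreal (c2 * norm x powr - e) * ?I u (norm x)"
          by (intro Hoelder u g) auto
        also have "\<dots> = ennreal c2 * (ennreal (norm x powr - e) * ?I u (norm x))"
          using c2 by (simp add: ennreal_mult mult.assoc)
        finally show ?case by (auto simp: indicator_def)
      qed
    qed
    also have "\<dots> = ennreal c2 * (\<integral>\<^sup>+x\<in>ball (0::'a) r. ennreal (norm x powr - e) * ?I u (norm x) \<partial>lebesgue)"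
    proof (rule nn_integral_cmult)
      interpret L: sigma_finite_measure "lebesgue :: 'a measure" by (rule sigma_finite_lebesgue)
      note nm [measurable] = borel_measurable_lebesgue_norm[where 'a="'a"]
      have [measurable]: "(\<lambda>q. norm (fst q)) \<in> borel_measurable (lebesgue \<Otimes>\<^sub>M lebesgue :: ('a \<times> 'a) measure)"
        "(\<lambda>q. norm (snd q)) \<in> borel_measurable (lebesgue \<Otimes>\<^sub>M lebesgue :: ('a \<times> 'a) measure)"
        using measurable_compose[OF measurable_fst nm] measurable_compose[OF measurable_snd nm] by auto
      note [measurable] = u(1)
      have "(\<lambda>x::'a. ?I u (norm x)) \<in> borel_measurable lebesgue"
        unfolding indicator_def mem_Collect_eq
        by (rule L.borel_measurable_nn_integral) (unfold case_prod_beta', measurable)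
      then show "(\<lambda>x. ennreal (norm x powr - e) * ?I u (norm x) * indicator (ball (0::'a) r) x) \<in> borel_measurable lebesgue"
        by measurable
    qed
    also have "\<dots> \<le> ennreal c2 * ennreal (c4 * A powr p * r powr l)"
      unfolding c4_def c1_def
      using c5 e l by (intro mult_left_mono hardy_dual_bound_at_centre u M r) auto
    also have "\<dots> = ennreal (c2 * (c4 * A powr p * r powr l))"
      using c2 c4 by (intro ennreal_mult[symmetric]) auto
    finally show ?thesis by (simp add: mult.assoc)
  qed
  \<comment> \<open>The summand \<open>c3 * V\<close> belongs to balls away from the origin,
    \<open>c2 * c4 * 3 powr l\<close> to balls contained in \<open>ball 0 (3 * r)\<close>.\<close>
  define C where "C = (c3 * V + c2 * c4 * 3 powr l) powr (1 / p)"
  have Cp: "0 < c3 * V + c2 * c4 * 3 powr l"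
    using c2 c3 c4 V by (intro add_pos_pos mult_pos_pos) auto
  show thesis
  proof (rule that[of C])
    show "0 < C" using Cp by (simp add: C_def)
  next
    fix u :: "'a \<Rightarrow> real" and A s
    assume u: "u \<in> borel_measurable lebesgue" "\<And>y. 0 \<le> u y" "morrey_bounded p l A u" and s: "(0::real) < s"
    \<comment> \<open>\<open>K powr p\<close> exceeds the pointwise bound by \<open>1\<close>, so
      \<open>K\<close> cannot lie below the integral, which is therefore finite.\<close>
    define K where "K = (c3 * A powr p * s powr (l - ?n) + 1) powr (1 / p)"
    have "0 \<le> c3 * A powr p * s powr (l - ?n)" using c3 by simp
    then have "K powr p = c3 * A powr p * s powr (l - ?n) + 1"
      using p unfolding K_def by (subst powr_powr) (simp add: add_nonneg_nonneg)
    then have "\<not> ennreal K \<le> ?T u s"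
      using pointwise[OF u s, of K] by (auto simp: K_def)
    then have "?T u s < ennreal K" by simp
    also have "\<dots> < \<infinity>" by simp
    finally show "?T u s < \<infinity>" .
  next
    fix u g :: "'a \<Rightarrow> real" and A
    assume u: "u \<in> borel_measurable lebesgue" "\<And>y. 0 \<le> u y" and gm [measurable]: "g \<in> borel_measurable lebesgue"
      and g: "\<And>y. 0 \<le> g y" and A: "0 < A" and M: "morrey_bounded p l A u"
      and gT: "\<And>x. x \<noteq> 0 \<Longrightarrow> ennreal (g x) \<le> ?T u (norm x)"
    have away: "(\<integral>\<^sup>+y\<in>ball x r \<inter> {y. s \<le> norm y}. ennreal (g y powr p) \<partial>lebesgue)
        \<le> ennreal (c3 * A powr p * s powr (l - ?n) * (V * r ^ ?n))" if s: "0 < s" and r: "0 < r" for x r s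
    proof -
      have "(\<integral>\<^sup>+y\<in>ball x r \<inter> {y. s \<le> norm y}. ennreal (g y powr p) \<partial>lebesgue)
          \<le> (\<integral>\<^sup>+y. ennreal (c3 * A powr p * s powr (l - ?n)) * indicator (ball x r) y \<partial>lebesgue)"
      proof (rule nn_integral_mono)
        fix y
        show "ennreal (g y powr p) * indicator (ball x r \<inter> {y. s \<le> norm y}) y
            \<le> ennreal (c3 * A powr p * s powr (l - ?n)) * indicator (ball x r) y"
        proof (cases "y \<in> ball x r \<inter> {y. s \<le> norm y}")
          case True
          then have y: "y \<noteq> 0" "s \<le> norm y" using s by auto
          then have "g y powr p \<le> c3 * A powr p * norm y powr (l - ?n)"
            using pointwise[OF u M, of "norm y" "g y"] g gT by simp
          also have "\<dots> \<le> c3 * A powr p * s powr (l - ?n)"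
            using s y l c3 by (intro mult_left_mono powr_mono2') auto
          finally show ?thesis using True by (auto intro: ennreal_leI)
        qed auto
      qed
      also have "\<dots> = ennreal (c3 * A powr p * s powr (l - ?n)) * ennreal (V * r ^ ?n)"
        using r by (subst nn_integral_cmult_indicator) (auto simp: emeasure_ball V_def)
      also have "\<dots> = ennreal (c3 * A powr p * s powr (l - ?n) * (V * r ^ ?n))"
        using c3 V r by (intro ennreal_mult[symmetric]) auto
      finally show ?thesis .
    qed
    show "morrey_bounded p l (C * A) g \<and> uniformly_vanishing p g"
    proof
      show "morrey_bounded p l (C * A) g"
        unfolding morrey_bounded_def
      proof (intro allI impI)
        fix x :: 'a and r :: real assume r: "0 < r"
        have CA: "(C * A) powr p * r powr l = (c3 * V + c2 * c4 * 3 powr l) * (A powr p * r powr l)"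
          using Cp A p by (simp add: C_def powr_mult powr_powr)
        show "(\<integral>\<^sup>+y\<in>ball x r. ennreal (g y powr p) \<partial>lebesgue) \<le> ennreal ((C * A) powr p * r powr l)"
        proof (cases "2 * r \<le> norm x")
          case True
          have "y \<in> ball x r \<Longrightarrow> r \<le> norm y" for y
            using True norm_triangle_ineq2[of x y] by (auto simp: dist_norm)
          then have "ball x r = ball x r \<inter> {y. r \<le> norm y}" by blast
          then have "(\<integral>\<^sup>+y\<in>ball x r. ennreal (g y powr p) \<partial>lebesgue)
              \<le> ennreal (c3 * A powr p * r powr (l - ?n) * (V * r ^ ?n))"
            using away[OF r r, of x] by simp
          also have "c3 * A powr p * r powr (l - ?n) * (V * r ^ ?n) = c3 * V * (A powr p * r powr l)"
            using r by (simp add: powr_diff powr_realpow)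
          also have "ennreal \<dots> \<le> ennreal ((C * A) powr p * r powr l)"
            unfolding CA using c2 c4 by (intro ennreal_leI mult_right_mono) auto
          finally show ?thesis .
        next
          case False
          have "ball x r \<subseteq> ball 0 (3 * r)"
          proof
            fix y assume "y \<in> ball x r"
            then show "y \<in> ball 0 (3 * r)"
              using False norm_triangle_ineq2[of y x] by (auto simp: dist_norm norm_minus_commute)
          qed
          then have "(\<integral>\<^sup>+y\<in>ball x r. ennreal (g y powr p) \<partial>lebesgue) \<le> (\<integral>\<^sup>+y\<in>ball 0 (3 * r). ennreal (g y powr p) \<partial>lebesgue)"
            by (intro nn_integral_mono) (auto simp: indicator_def)
          also have "\<dots> \<le> ennreal (c2 * c4 * A powr p * (3 * r) powr l)"
            using r by (intro near[OF u M g gT]) auto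
          also have "\<dots> \<le> ennreal ((C * A) powr p * r powr l)"
            unfolding CA using c3 V r by (intro ennreal_leI) (simp add: powr_mult algebra_simps)
          finally show ?thesis .
        qed
      qed
      show "uniformly_vanishing p g"
        unfolding uniformly_vanishing_def
      proof (intro allI impI)
        fix \<epsilon> :: real assume \<epsilon>: "0 < \<epsilon>"
        \<comment> \<open>\<open>N\<close> will satisfy \<open>N powr (l - n) \<le> 1 / Q\<close>,
          possible because \<open>l < n\<close>; this brings the bound
          \<open>c3 A^p V N^(l-n)\<close> on unit balls down to \<epsilon>.\<close>
        define Q where "Q = c3 * A powr p * V / \<epsilon>"
        have Q: "0 < Q" using c3 A V \<epsilon> by (simp add: Q_def)
        obtain N :: nat where N: "max 1 (Q powr (1 / (?n - l))) \<le> real N" using real_arch_simple by blast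
        have "real N powr (l - ?n) \<le> (Q powr (1 / (?n - l))) powr (l - ?n)"
          using N l Q by (intro powr_mono2') auto
        also have "\<dots> = inverse Q"
        proof -
          have "1 / (?n - l) * (l - ?n) = - 1" using l by (simp add: field_simps)
          then show ?thesis using Q by (simp add: powr_powr powr_minus)
        qed
        finally have "c3 * A powr p * V * real N powr (l - ?n) \<le> c3 * A powr p * V * inverse Q"
          using c3 V by (intro mult_left_mono) auto
        also have "\<dots> = \<epsilon>" using c3 A V \<epsilon> by (simp add: Q_def)
        finally have NQ: "c3 * A powr p * real N powr (l - ?n) * (V * 1 ^ ?n) \<le> \<epsilon>" by (simp add: mult_ac)
        show "\<exists>N::nat. \<forall>x. (\<integral>\<^sup>+y\<in>ball x 1 \<inter> {y. real N \<le> norm y}. ennreal (g y powr p) \<partial>lebesgue) \<le> ennreal \<epsilon>"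
          using order_trans[OF away[of "real N" 1] ennreal_leI[OF NQ]] N by (intro exI[of _ N]) auto
      qed
    qed
  qed
qed

subsection \<open>Integrals depending on a parameter\<close>

text \<open>Dominated convergence along sequences. The region of integration moves with
  \<open>x\<close>, but off the null set \<open>\<phi> x0 y = 0\<close> the membership of
  \<open>y\<close> is eventually constant, so the integrands converge almost everywhere. The
  measurability of all three operators rests on this.\<close>

lemma continuous_on_parametric_integral:
  fixes F :: "'c::metric_space \<Rightarrow> 'a::euclidean_space \<Rightarrow> 'b::{banach,second_countable_topology}"
    and \<phi> :: "'c \<Rightarrow> 'a \<Rightarrow> real"
  assumes \<phi>: "\<And>y. continuous_on S (\<lambda>x. \<phi> x y)" and F: "\<And>y. continuous_on S (\<lambda>x. F x y)"
    and meas: "\<And>x. x \<in> S \<Longrightarrow> F x \<in> borel_measurable lebesgue"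
    and sets: "\<And>x. x \<in> S \<Longrightarrow> {y. \<phi> x y < 0} \<in> sets lebesgue"
    and null: "\<And>x. x \<in> S \<Longrightarrow> {y. \<phi> x y = 0} \<in> null_sets lebesgue"
    and dom: "\<And>x0. x0 \<in> S \<Longrightarrow> \<exists>d>0. \<exists>w. integrable lebesgue w \<and>
        (\<forall>x\<in>S \<inter> ball x0 d. \<forall>y. \<phi> x y < 0 \<longrightarrow> norm (F x y) \<le> w y) \<and> (\<forall>y. 0 \<le> w y)"
  shows "continuous_on S (\<lambda>x. LINT y:{y. \<phi> x y < 0}|lebesgue. F x y)"
  unfolding continuous_on_sequentially
proof (intro allI ballI impI, elim conjE)
  fix X :: "nat \<Rightarrow> 'c" and x0
  assume x0: "x0 \<in> S" and X: "\<forall>n. X n \<in> S" "X \<longlonglongrightarrow> x0"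
  obtain d w where d: "0 < d" and w: "integrable lebesgue w" "\<And>y. 0 \<le> w y"
    "\<And>x y. x \<in> S \<Longrightarrow> x \<in> ball x0 d \<Longrightarrow> \<phi> x y < 0 \<Longrightarrow> norm (F x y) \<le> w y"
    using dom[OF x0] by blast
  \<comment> \<open>Domination holds only near \<open>x0\<close>, so the first \<open>N\<close>
    terms are discarded and put back by \<open>LIMSEQ_offset\<close>.\<close>
  obtain N where N: "\<And>n. N \<le> n \<Longrightarrow> X n \<in> ball x0 d"
    using X(2) d unfolding lim_sequentially by (auto simp: dist_commute)
  let ?G = "\<lambda>x y. indicator {y. \<phi> x y < 0} y *\<^sub>R F x y"
  have "(\<lambda>n. integral\<^sup>L lebesgue (?G (X (n + N)))) \<longlonglongrightarrow> integral\<^sup>L lebesgue (?G x0)"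
  proof (rule integral_dominated_convergence[where w = w])
    show "?G x0 \<in> borel_measurable lebesgue" "\<And>n. ?G (X (n + N)) \<in> borel_measurable lebesgue"
      using meas sets x0 X(1) by (auto intro!: borel_measurable_scaleR borel_measurable_indicator)
    show "AE y in lebesgue. norm (?G (X (n + N)) y) \<le> w y" for n
      using w X(1) N[of "n + N"] by (auto simp: indicator_def)
    have "AE y in lebesgue. y \<notin> {y. \<phi> x0 y = 0}"
      by (rule AE_not_in[OF null[OF x0]])
    then show "AE y in lebesgue. (\<lambda>n. ?G (X (n + N)) y) \<longlonglongrightarrow> ?G x0 y"
    proof eventually_elim
      case (elim y)
      have Xt: "(\<lambda>n. X (n + N)) \<longlonglongrightarrow> x0" using X(2) by (rule LIMSEQ_ignore_initial_segment)
      have ev: "\<forall>\<^sub>F n in sequentially. X (n + N) \<in> S" using X(1) by simp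
      have \<phi>t: "(\<lambda>n. \<phi> (X (n + N)) y) \<longlonglongrightarrow> \<phi> x0 y"
        using continuous_on_tendsto_compose[OF \<phi> Xt x0 ev] .
      have Ft: "(\<lambda>n. F (X (n + N)) y) \<longlonglongrightarrow> F x0 y"
        using continuous_on_tendsto_compose[OF F Xt x0 ev] .
      show ?case
      proof (cases "\<phi> x0 y < 0")
        case True
        then have "\<forall>\<^sub>F n in sequentially. \<phi> (X (n + N)) y < 0" using order_tendstoD(2)[OF \<phi>t] by blast
        then have "\<forall>\<^sub>F n in sequentially. F (X (n + N)) y = ?G (X (n + N)) y"
          by eventually_elim simp
        then show ?thesis using Lim_transform_eventually[OF Ft] True by simp
      next
        case False
        then have "0 < \<phi> x0 y" using elim by simp
        then have "\<forall>\<^sub>F n in sequentially. 0 < \<phi> (X (n + N)) y" using order_tendstoD(1)[OF \<phi>t] by blast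
        then have "\<forall>\<^sub>F n in sequentially. ?G (X (n + N)) y = 0"
          by eventually_elim simp
        then show ?thesis using False by (simp add: tendsto_eventually)
      qed
    qed
  qed (use w in auto)
  then have "(\<lambda>n. integral\<^sup>L lebesgue (?G (X n))) \<longlonglongrightarrow> integral\<^sup>L lebesgue (?G x0)"
    by (rule LIMSEQ_offset)
  then show "((\<lambda>x. LINT y:{y. \<phi> x y < 0}|lebesgue. F x y) \<circ> X) \<longlonglongrightarrow> (LINT y:{y. \<phi> x0 y < 0}|lebesgue. F x0 y)"
    by (simp add: set_lebesgue_integral_def comp_def)
qed

text \<open>The region is \<open>dist (c x) y - \<rho> x < 0\<close>, with a sphere as its null
  boundary. Moving centres serve the averages of the sharp maximal function, moving radii the Hardy
  operator.\<close>

lemma continuous_on_integral_ball: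
  fixes F :: "'a::euclidean_space \<Rightarrow> 'a \<Rightarrow> 'b::{banach,second_countable_topology}" and \<rho> :: "'a \<Rightarrow> real"
  assumes c: "continuous_on UNIV c" and \<rho>: "continuous_on UNIV \<rho>"
    and F: "\<And>y. continuous_on UNIV (\<lambda>x. F x y)" "\<And>x. F x \<in> borel_measurable lebesgue"
    and dom: "\<And>R. \<exists>w. (\<forall>r. set_integrable lebesgue (ball 0 r) w) \<and> (\<forall>x\<in>ball 0 R. \<forall>y. norm (F x y) \<le> w y)"
  shows "continuous_on UNIV (\<lambda>x. LINT y:ball (c x) (\<rho> x)|lebesgue. F x y)"
proof -
  have "continuous_on UNIV (\<lambda>x. LINT y:{y. dist (c x) y - \<rho> x < 0}|lebesgue. F x y)"
  proof (rule continuous_on_parametric_integral)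
    fix x0 :: 'a
    have "sphere (c x0) (\<rho> x0) = {y. dist (c x0) y - \<rho> x0 = 0}" by auto
    then show "{y. dist (c x0) y - \<rho> x0 = 0} \<in> null_sets lebesgue"
      using negligible_sphere[of "c x0" "\<rho> x0"] by (simp add: negligible_iff_null_sets)
    have "ball (c x0) (\<rho> x0) = {y. dist (c x0) y - \<rho> x0 < 0}" by auto
    then show "{y. dist (c x0) y - \<rho> x0 < 0} \<in> sets lebesgue"
      using sets_completionI_sets[of "ball (c x0) (\<rho> x0)" lborel] by simp
    obtain w where w: "\<And>r. set_integrable lebesgue (ball 0 r) w"
      "\<And>x y. x \<in> ball 0 (norm x0 + 1) \<Longrightarrow> norm (F x y) \<le> w y" using dom[of "norm x0 + 1"] by blast
    obtain d1 d2 where d12: "0 < d1" "\<And>x. dist x x0 < d1 \<Longrightarrow> dist (c x) (c x0) < 1"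
        "0 < d2" "\<And>x. dist x x0 < d2 \<Longrightarrow> dist (\<rho> x) (\<rho> x0) < 1"
      using c \<rho> unfolding continuous_on_iff by (metis UNIV_I zero_less_one)
    define d where "d = min 1 (min d1 d2)"
    \<comment> \<open>Near \<open>x0\<close> both \<open>c\<close> and \<open>\<rho>\<close> change
      by less than \<open>1\<close>, so all the balls lie in one ball of this radius.\<close>
    define R where "R = norm (c x0) + \<rho> x0 + 2"
    have "norm (F x y) \<le> w y \<and> y \<in> ball 0 R"
      if x: "x \<in> ball x0 d" and y: "dist (c x) y - \<rho> x < 0" for x y
    proof
      have "norm x \<le> norm x0 + dist x0 x" using norm_triangle_sub[of x x0] by (simp add: dist_norm norm_minus_commute)
      then show "norm (F x y) \<le> w y" using x by (intro w) (auto simp: d_def)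
      have "dist (c x) (c x0) < 1" "dist (\<rho> x) (\<rho> x0) < 1"
        using x d12(2)[of x] d12(4)[of x] by (auto simp: d_def dist_commute)
      moreover have "norm y \<le> norm (c x0) + dist (c x) (c x0) + dist (c x) y"
        using dist_triangle[of 0 y "c x0"] dist_triangle[of "c x0" y "c x"] by (simp add: dist_commute)
      moreover have "\<rho> x \<le> \<rho> x0 + dist (\<rho> x) (\<rho> x0)" by (simp add: dist_real_def)
      ultimately have "norm y < R" using y unfolding R_def by linarith
      then show "y \<in> ball 0 R" by simp
    qed
    moreover have "0 \<le> w y" for y
      using w(2)[of 0 y] order_trans[OF norm_ge_zero] by (auto simp: add_nonneg_pos)
    moreover have "0 < d" using d12 by (simp add: d_def)
    ultimately show "\<exists>d>0. \<exists>w. integrable lebesgue w \<and>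
        (\<forall>x\<in>UNIV \<inter> ball x0 d. \<forall>y. dist (c x) y - \<rho> x < 0 \<longrightarrow> norm (F x y) \<le> w y) \<and> (\<forall>y. 0 \<le> w y)"
      using w(1)[of R] unfolding set_integrable_def
      by (intro exI[of _ d] conjI exI[of _ "\<lambda>y. indicator (ball 0 R) y *\<^sub>R w y"]) auto
  qed (use F in \<open>auto intro!: continuous_intros continuous_on_compose2[OF c] continuous_on_compose2[OF \<rho>]\<close>)
  moreover have "{y. dist (c x) y - \<rho> x < 0} = ball (c x) (\<rho> x)" for x by auto
  ultimately show ?thesis by simp
qed

subsection \<open>Passage to the Morrey norm\<close>

lemma set_nn_integral_eq_set_integral:
  assumes "set_integrable M S f" "\<And>x. 0 \<le> f x"
  shows "(\<integral>\<^sup>+x\<in>S. ennreal (f x) \<partial>M) = ennreal (LINT x:S|M. f x)"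
proof -
  have "(\<integral>\<^sup>+x\<in>S. ennreal (f x) \<partial>M) = (\<integral>\<^sup>+x. ennreal (indicator S x *\<^sub>R f x) \<partial>M)"
    by (intro nn_integral_cong) (auto simp: indicator_def)
  also have "\<dots> = ennreal (LINT x:S|M. f x)"
    unfolding set_lebesgue_integral_def
    using assms by (intro nn_integral_eq_integral) (auto simp: set_integrable_def)
  finally show ?thesis .
qed

lemma set_integrable_iff_nn_integral_norm:
  fixes f :: "'a \<Rightarrow> 'b::{banach,second_countable_topology}"
  assumes [measurable]: "f \<in> borel_measurable M" "S \<in> sets M"
  shows "set_integrable M S f \<longleftrightarrow> (\<integral>\<^sup>+x\<in>S. ennreal (norm (f x)) \<partial>M) < \<infinity>"
proof -
  have "(\<integral>\<^sup>+x. ennreal (norm (indicator S x *\<^sub>R f x)) \<partial>M) = (\<integral>\<^sup>+x\<in>S. ennreal (norm (f x)) \<partial>M)"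
    by (intro nn_integral_cong) (auto simp: indicator_def)
  moreover have "(\<lambda>x. indicator S x *\<^sub>R f x) \<in> borel_measurable M" by measurable
  ultimately show ?thesis by (simp add: set_integrable_def integrable_iff_bounded)
qed

text \<open>Integrability is not assumed: the Bochner integral of a non-integrable function is
  \<open>0\<close>. Pointwise bounds on the operators thus hold at every point.\<close>

lemma norm_set_integral_le_nn_integral:
  fixes f :: "'a \<Rightarrow> 'b::{banach,second_countable_topology}"
  shows "ennreal (norm (LINT x:S|M. f x)) \<le> (\<integral>\<^sup>+x\<in>S. ennreal (norm (f x)) \<partial>M)"
proof (cases "set_integrable M S f")
  case True
  have "(\<integral>\<^sup>+x. ennreal (norm (indicator S x *\<^sub>R f x)) \<partial>M) = (\<integral>\<^sup>+x\<in>S. ennreal (norm (f x)) \<partial>M)"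
    by (intro nn_integral_cong) (auto simp: indicator_def)
  then show ?thesis
    using integral_norm_bound_ennreal[of M "\<lambda>x. indicator S x *\<^sub>R f x"] True
    by (simp add: set_integrable_def set_lebesgue_integral_def)
next
  case False
  then show ?thesis by (simp add: set_integrable_def set_lebesgue_integral_def not_integrable_integral_eq)
qed

lemma locally_p_integrable_ball:
  assumes "locally_p_integrable p f"
  shows "set_integrable lebesgue (ball x r) (\<lambda>y. norm (f y) powr p)"
proof (rule set_integrable_subset)
  show "set_integrable lebesgue (cball x r) (\<lambda>y. norm (f y) powr p)"
    using assms by (simp add: locally_p_integrable_def)
qed auto

lemma morrey_quot_nonneg: "0 \<le> morrey_quot p l f x r"
  by (simp add: morrey_quot_def)

lemma morrey_quot_le_norm:
  assumes "f \<in> morrey_space p l" "0 < r"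
  shows "morrey_quot p l f x r \<le> morrey_norm p l f"
  using cSUP_upper[of "(x, r)" "UNIV \<times> {0<..}" "\<lambda>(x, r). morrey_quot p l f x r"] assms
  by (simp add: morrey_norm_def morrey_space_def)

lemma morrey_norm_nonneg:
  assumes "f \<in> morrey_space p l"
  shows "0 \<le> morrey_norm p l f"
  by (rule order_trans[OF morrey_quot_nonneg morrey_quot_le_norm[OF assms zero_less_one]])

text \<open>The strict inequality makes \<open>A\<close> positive even where the norm is
  \<open>0\<close>, as the estimates require. Membership in the space ensures that the real supremum
  is taken over a bounded set and bounds every quotient.\<close>

lemma morrey_bounded_of_norm_less:
  assumes f: "f \<in> morrey_space p l" and p: "1 < p" and A: "morrey_norm p l f < A"
  shows "morrey_bounded p l A (\<lambda>y. norm (f y))"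
  unfolding morrey_bounded_def
proof (intro allI impI)
  fix x r assume r: "(0::real) < r"
  define J where "J = (LINT y:ball x r|lebesgue. norm (f y) powr p)"
  have int: "set_integrable lebesgue (ball x r) (\<lambda>y. norm (f y) powr p)"
    using f by (intro locally_p_integrable_ball) (simp add: morrey_space_def)
  have J: "0 \<le> J" unfolding J_def set_lebesgue_integral_def by (intro integral_nonneg_AE) auto
  have "((1 / r powr l) * J) powr (1 / p) \<le> A"
    using morrey_quot_le_norm[OF f r, of x] A by (simp add: morrey_quot_def J_def)
  then have "(((1 / r powr l) * J) powr (1 / p)) powr p \<le> A powr p"
    using p by (intro powr_mono2) auto
  then have "(1 / r powr l) * J \<le> A powr p"
    using p J by (simp add: powr_powr)
  then have "J \<le> A powr p * r powr l"
    using r by (simp add: field_simps)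
  then show "(\<integral>\<^sup>+y\<in>ball x r. ennreal (norm (f y) powr p) \<partial>lebesgue) \<le> ennreal (A powr p * r powr l)"
    using set_nn_integral_eq_set_integral[OF int] by (simp add: J_def ennreal_leI)
qed

text \<open>Finite nonnegative integrals make \<open>norm (f y) powr p\<close> integrable on balls,
  so the Bochner integrals in \<open>morrey_quot\<close> are genuine and the real supremum is over a
  bounded set.\<close>

lemma morrey_spaceI:
  fixes f :: "real ^ 'n \<Rightarrow> 'b::{banach,second_countable_topology}"
  assumes [measurable]: "f \<in> borel_measurable lebesgue" and p: "1 < p" and A: "0 < A"
    and M: "morrey_bounded p l A (\<lambda>y. norm (f y))"
  shows "f \<in> morrey_space p l" "morrey_norm p l f \<le> A"
proof -
  have int: "set_integrable lebesgue (ball x r) (\<lambda>y. norm (f y) powr p)" for x r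
  proof (cases "0 < r")
    case True
    then have "(\<integral>\<^sup>+y\<in>ball x r. ennreal (norm (f y) powr p) \<partial>lebesgue) \<le> ennreal (A powr p * r powr l)"
      using M by (simp add: morrey_bounded_def)
    also have "\<dots> < \<infinity>" by simp
    finally show ?thesis by (subst set_integrable_iff_nn_integral_norm) auto
  next
    case False
    then show ?thesis by (simp add: set_integrable_def ball_empty)
  qed
  have quot: "morrey_quot p l f x r \<le> A" if r: "0 < r" for x r
  proof -
    define J where "J = (LINT y:ball x r|lebesgue. norm (f y) powr p)"
    have J: "0 \<le> J" unfolding J_def set_lebesgue_integral_def by (intro integral_nonneg_AE) auto
    have "(\<integral>\<^sup>+y\<in>ball x r. ennreal (norm (f y) powr p) \<partial>lebesgue) \<le> ennreal (A powr p * r powr l)"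
      using M r by (simp add: morrey_bounded_def)
    then have "ennreal J \<le> ennreal (A powr p * r powr l)"
      using set_nn_integral_eq_set_integral[OF int[of x r]] by (simp add: J_def)
    then have "J \<le> A powr p * r powr l" by (subst (asm) ennreal_le_iff) auto
    then have "(1 / r powr l) * J \<le> A powr p" using r by (simp add: field_simps)
    then have "((1 / r powr l) * J) powr (1 / p) \<le> (A powr p) powr (1 / p)"
      using J p by (intro powr_mono2) auto
    then show ?thesis using A p by (simp add: morrey_quot_def J_def powr_powr)
  qed
  have "locally_p_integrable p f"
    unfolding locally_p_integrable_def
  proof (intro conjI allI impI)
    fix K :: "(real ^ 'n) set" assume K: "compact K"
    then obtain R where "K \<subseteq> ball 0 R" using bounded_subset_ballD[OF compact_imp_bounded] by blast
    then show "set_integrable lebesgue K (\<lambda>y. norm (f y) powr p)"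
      using K by (intro set_integrable_subset[OF int]) (auto simp: borel_compact sets_completionI_sets)
  qed fact
  then show "f \<in> morrey_space p l"
    using quot by (auto simp: morrey_space_def intro!: bdd_aboveI2)
  show "morrey_norm p l f \<le> A"
    unfolding morrey_norm_def using quot by (intro cSUP_least) auto
qed

text \<open>In the Morrey space the integrals \<open>J N x\<close> are bounded by
  \<open>A powr p\<close> (radius \<open>1\<close>), so the real suprema are genuine; they decrease
  in \<open>N\<close>, so one good \<open>N\<close> settles all later ones.\<close>

lemma vanishing_morrey_space_iff:
  fixes f :: "real ^ 'n \<Rightarrow> 'b::{banach,second_countable_topology}"
  assumes p: "1 < p"
  shows "f \<in> vanishing_morrey_space p l \<longleftrightarrow> f \<in> morrey_space p l \<and> uniformly_vanishing p (\<lambda>y. norm (f y))"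
proof (cases "f \<in> morrey_space p l")
  case f: True
  define J where "J N x = (LINT y:ball x 1|lebesgue. norm (f y) powr p * indicator (UNIV - ball 0 (real N)) y)"
    for N :: nat and x
  obtain A where A: "morrey_norm p l f < A" using gt_ex by blast
  have fm [measurable]: "f \<in> borel_measurable lebesgue"
    using f by (simp add: morrey_space_def locally_p_integrable_def)
  have nonneg: "0 \<le> J N x" for N x
    unfolding J_def set_lebesgue_integral_def by (intro integral_nonneg_AE) auto
  have eq: "(\<integral>\<^sup>+y\<in>ball x 1 \<inter> {y. real N \<le> norm y}. ennreal (norm (f y) powr p) \<partial>lebesgue) = ennreal (J N x)" for N x
  proof -
    have "set_integrable lebesgue (ball x 1) (\<lambda>y. norm (f y) powr p)"
      using f by (intro locally_p_integrable_ball) (simp add: morrey_space_def)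
    moreover have "(\<lambda>y. indicator (ball x 1) y *\<^sub>R (norm (f y) powr p * indicator (UNIV - ball 0 (real N)) y))
        \<in> borel_measurable lebesgue"
      by (intro borel_measurable_scaleR borel_measurable_times borel_measurable_indicator) auto
    ultimately have "set_integrable lebesgue (ball x 1) (\<lambda>y. norm (f y) powr p * indicator (UNIV - ball 0 (real N)) y)"
      unfolding set_integrable_def
      by (rule Bochner_Integration.integrable_bound) (auto simp: indicator_def)
    from set_nn_integral_eq_set_integral[OF this]
    have "ennreal (J N x) = (\<integral>\<^sup>+y\<in>ball x 1. ennreal (norm (f y) powr p * indicator (UNIV - ball 0 (real N)) y) \<partial>lebesgue)"
      by (simp add: J_def)
    also have "\<dots> = (\<integral>\<^sup>+y\<in>ball x 1 \<inter> {y. real N \<le> norm y}. ennreal (norm (f y) powr p) \<partial>lebesgue)"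
      by (intro nn_integral_cong) (auto simp: indicator_def)
    finally show ?thesis by simp
  qed
  have mono: "J N x \<le> J N' x" if "N' \<le> N" for N N' x
  proof -
    have "ennreal (J N x) \<le> ennreal (J N' x)"
      unfolding eq[symmetric] using that by (intro nn_integral_mono) (auto simp: indicator_def)
    then show ?thesis using nonneg by simp
  qed
  have "J N x \<le> A powr p" for N x
  proof -
    have "ennreal (J N x) \<le> (\<integral>\<^sup>+y\<in>ball x 1. ennreal (norm (f y) powr p) \<partial>lebesgue)"
      unfolding eq[symmetric] by (intro nn_integral_mono) (auto simp: indicator_def)
    also have "\<dots> \<le> ennreal (A powr p * 1 powr l)"
      using morrey_bounded_of_norm_less[OF f p A] 
      by (intro morrey_bounded_def[THEN iffD1, rule_format]) auto
    finally show ?thesis by simp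
  qed
  then have bdd: "bdd_above (range (J N))" for N by (auto intro!: bdd_aboveI2)
  have "(\<lambda>N. SUP x. J N x) \<longlonglongrightarrow> 0 \<longleftrightarrow> (\<forall>\<epsilon>>0. \<exists>N::nat. \<forall>x. ennreal (J N x) \<le> ennreal \<epsilon>)"
  proof
    assume lim: "(\<lambda>N. SUP x. J N x) \<longlonglongrightarrow> 0"
    show "\<forall>\<epsilon>>0. \<exists>N::nat. \<forall>x. ennreal (J N x) \<le> ennreal \<epsilon>"
    proof (intro allI impI)
      fix \<epsilon> :: real assume "0 < \<epsilon>"
      from order_tendstoD(2)[OF lim this] obtain N where N: "(SUP x. J N x) < \<epsilon>"
        by (auto simp: eventually_sequentially)
      have "J N x \<le> \<epsilon>" for x using cSUP_upper[OF UNIV_I bdd[of N], of x] N by simp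
      then show "\<exists>N::nat. \<forall>x. ennreal (J N x) \<le> ennreal \<epsilon>" by (auto intro: ennreal_leI)
    qed
  next
    assume van: "\<forall>\<epsilon>>0. \<exists>N::nat. \<forall>x. ennreal (J N x) \<le> ennreal \<epsilon>"
    show "(\<lambda>N. SUP x. J N x) \<longlonglongrightarrow> 0"
    proof (rule LIMSEQ_I)
      fix \<epsilon> :: real assume \<epsilon>: "0 < \<epsilon>"
      then obtain N0 where N0: "\<And>x. ennreal (J N0 x) \<le> ennreal (\<epsilon> / 2)" using van half_gt_zero by blast
      have "norm ((SUP x. J N x) - 0) < \<epsilon>" if N: "N0 \<le> N" for N
      proof -
        have "J N x \<le> \<epsilon> / 2" for x
          using mono[OF N, of x] N0[of x] \<epsilon> by (subst (asm) ennreal_le_iff) auto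
        then have "(SUP x. J N x) \<le> \<epsilon> / 2" by (intro cSUP_least) auto
        moreover have "0 \<le> (SUP x. J N x)"
          by (rule order_trans[OF nonneg cSUP_upper[OF UNIV_I bdd]])
        ultimately show ?thesis using \<epsilon> by simp
      qed
      then show "\<exists>no. \<forall>n\<ge>no. norm ((SUP x. J n x) - 0) < \<epsilon>" by blast
    qed
  qed
  then show ?thesis
    using f unfolding vanishing_morrey_space_def uniformly_vanishing_def eq by (simp add: J_def)
qed (simp add: vanishing_morrey_space_def)

text \<open>The estimate is required for every \<open>A\<close> above the norm of \<open>f\<close>,
  and letting \<open>A\<close> decrease to the norm gives the bound; a single such \<open>A\<close>
  already yields membership and well-definedness.\<close>

lemma bounded_in_vanishing_morreyI:
  fixes T :: "(real ^ 'n \<Rightarrow> 'b::{banach,second_countable_topology}) \<Rightarrow> real ^ 'n \<Rightarrow> 'c::{banach,second_countable_topology}"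
  assumes p: "1 < p" and C: "0 < C"
    and T: "\<And>f A. \<lbrakk>f \<in> borel_measurable lebesgue; 0 < A; morrey_bounded p l A (\<lambda>y. norm (f y));
        uniformly_vanishing p (\<lambda>y. norm (f y))\<rbrakk> \<Longrightarrow>
      D f \<and> T f \<in> borel_measurable lebesgue \<and> morrey_bounded p l (C * A) (\<lambda>y. norm (T f y)) \<and>
      uniformly_vanishing p (\<lambda>y. norm (T f y))"
  shows "bounded_in_vanishing_morrey p l D T"
  unfolding bounded_in_vanishing_morrey_def
proof (intro exI[of _ C] ballI)
  fix f :: "real ^ 'n \<Rightarrow> 'b" assume "f \<in> vanishing_morrey_space p l"
  then have f: "f \<in> morrey_space p l" "uniformly_vanishing p (\<lambda>y. norm (f y))"
    using vanishing_morrey_space_iff[OF p] by blast+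
  have fm: "f \<in> borel_measurable lebesgue"
    using f(1) by (simp add: morrey_space_def locally_p_integrable_def)
  have TA: "D f" "T f \<in> vanishing_morrey_space p l" "morrey_norm p l (T f) \<le> C * A"
    if A: "morrey_norm p l f < A" for A
  proof -
    have A0: "0 < A" using A morrey_norm_nonneg[OF f(1)] by linarith
    have *: "D f" "T f \<in> borel_measurable lebesgue" "morrey_bounded p l (C * A) (\<lambda>y. norm (T f y))"
        "uniformly_vanishing p (\<lambda>y. norm (T f y))"
      using T[OF fm A0 morrey_bounded_of_norm_less[OF f(1) p A] f(2)] by auto
    have CA: "0 < C * A" using C A0 by simp
    show "D f" "T f \<in> vanishing_morrey_space p l" "morrey_norm p l (T f) \<le> C * A"
      using * morrey_spaceI[OF *(2) p CA *(3)] vanishing_morrey_space_iff[OF p] by blast+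
  qed
  have "morrey_norm p l (T f) / C \<le> A" if "morrey_norm p l f < A" for A
    using TA(3)[OF that] C by (simp add: field_simps)
  then have "morrey_norm p l (T f) / C \<le> morrey_norm p l f" by (rule dense_ge)
  then have "morrey_norm p l (T f) \<le> C * morrey_norm p l f" using C by (simp add: field_simps)
  moreover obtain A where "morrey_norm p l f < A" using gt_ex by blast
  ultimately show "D f \<and> T f \<in> vanishing_morrey_space p l \<and> morrey_norm p l (T f) \<le> C * morrey_norm p l f"
    using TA by blast
qed

subsection \<open>The three operators\<close>

lemma set_integrable_ball_of_morrey_bounded:
  fixes f :: "'a::euclidean_space \<Rightarrow> 'b::{banach,second_countable_topology}" and l :: real
  assumes f: "f \<in> borel_measurable lebesgue" and p: "1 < p" and l: "l < DIM('a)"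
    and A: "0 < A" and M: "morrey_bounded p l A (\<lambda>y. norm (f y))"
  shows "set_integrable lebesgue (ball x r) f"
proof (cases "0 < r")
  case True
  have "(\<integral>\<^sup>+z\<in>ball x r. ennreal (norm (f z)) \<partial>lebesgue)
      \<le> ennreal (2 * (A * unit_ball_vol DIM('a) powr (- 1 / p) * r powr ((l - DIM('a)) / p)))
        * emeasure lebesgue (ball x r)"
    using f True by (intro morrey_average_bound p l A M) auto
  also have "\<dots> < \<infinity>"
    using True by (simp add: emeasure_ball ennreal_mult_less_top)
  finally show ?thesis using f by (subst set_integrable_iff_nn_integral_norm) auto
qed (simp add: set_integrable_def ball_empty)

text \<open>On a ball \<open>B\<close>, \<open>|f - f_B| \<le> |f| + |f_B|\<close>, and
  \<open>|f_B| |B|\<close> is again at most the integral of \<open>|f|\<close> over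
  \<open>B\<close>; hence the factor \<open>2\<close>.\<close>

lemma sharp_maximal_le_maximal_function:
  fixes f :: "real ^ 'n \<Rightarrow> 'b::{banach,second_countable_topology}"
  assumes [measurable]: "f \<in> borel_measurable lebesgue"
  shows "sharp_maximal f x \<le> ennreal 2 * maximal_function (\<lambda>y. norm (f y)) x"
  unfolding sharp_maximal_def
proof (rule SUP_least)
  fix t :: real assume "t \<in> {0<..}"
  then have t: "0 < t" by simp
  let ?B = "ball x t" and ?I = "\<integral>\<^sup>+y\<in>ball x t. ennreal (norm (f y)) \<partial>lebesgue"
  let ?m = "mean_on (ball x t) f"
  define m where "m = unit_ball_vol CARD('n) * t ^ CARD('n)"
  have m: "0 < m" "emeasure lebesgue ?B = ennreal m" "measure lebesgue ?B = m"
    using t by (auto simp: m_def emeasure_ball content_ball)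
  have "ennreal (norm ?m) * ennreal m = ennreal (norm (LINT z:?B|lebesgue. f z))"
    using m by (simp add: mean_on_def flip: ennreal_mult)
  then have mean: "ennreal (norm ?m) * ennreal m \<le> ?I"
    using norm_set_integral_le_nn_integral[where S="?B" and M=lebesgue and f=f] by simp
  have "(\<integral>\<^sup>+y\<in>?B. ennreal (norm (f y - ?m)) \<partial>lebesgue)
      \<le> (\<integral>\<^sup>+y. ennreal (norm (f y)) * indicator ?B y + ennreal (norm ?m) * indicator ?B y \<partial>lebesgue)"
    by (intro nn_integral_mono)
      (auto simp: indicator_def norm_triangle_ineq4 simp flip: ennreal_plus intro!: ennreal_leI)
  also have "\<dots> = ?I + ennreal (norm ?m) * ennreal m"
    using m by (subst nn_integral_add) (auto simp: nn_integral_cmult_indicator)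
  also have "\<dots> \<le> ?I + ?I" by (intro add_left_mono mean)
  also have "\<dots> = ennreal 2 * ?I" by (simp add: mult_2)
  finally have "(\<integral>\<^sup>+y\<in>?B. ennreal (norm (f y - ?m)) \<partial>lebesgue) / emeasure lebesgue ?B
      \<le> ennreal 2 * ?I / emeasure lebesgue ?B" by (rule divide_right_mono_ennreal)
  also have "\<dots> = ennreal 2 * (?I / emeasure lebesgue ?B)" by (simp add: ennreal_times_divide)
  also have "\<dots> \<le> ennreal 2 * maximal_function (\<lambda>y. norm (f y)) x"
    unfolding maximal_function_def using t by (intro mult_left_mono SUP_upper) auto
  finally show "(\<integral>\<^sup>+y\<in>?B. ennreal (norm (f y - ?m)) \<partial>lebesgue) / emeasure lebesgue ?B
      \<le> ennreal 2 * maximal_function (\<lambda>y. norm (f y)) x" .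
qed

text \<open>The averages are continuous in the centre, so their supremum is lower semicontinuous.\<close>

lemma borel_measurable_sharp_maximal:
  fixes f :: "real ^ 'n \<Rightarrow> 'b::{banach,second_countable_topology}"
  assumes [measurable]: "f \<in> borel_measurable lebesgue" and int: "\<And>x r. set_integrable lebesgue (ball x r) f"
  shows "sharp_maximal f \<in> borel_measurable lebesgue"
proof -
  define V where "V t = unit_ball_vol CARD('n) * t ^ CARD('n)" for t :: real
  have V: "emeasure lebesgue (ball x t) = ennreal (V t)" "measure lebesgue (ball x t) = V t" if "0 < t"
    for x :: "real ^ 'n" and t
    using that by (auto simp: V_def emeasure_ball content_ball)
  have V0: "0 < V t" if "0 < t" for t using that by (simp add: V_def)
  have intn: "set_integrable lebesgue (ball x r) (\<lambda>y. norm (f y))" for x r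
    using int[of x r] by (simp add: set_integrable_iff_nn_integral_norm)
  have intc: "set_integrable lebesgue (ball x r) (\<lambda>y. c)" for x :: "real ^ 'n" and r c :: real
    using emeasure_lborel_ball_finite[of x r]
    by (subst set_integrable_iff_nn_integral_norm) (auto simp: nn_integral_cmult_indicator ennreal_mult_less_top)
  define h where "h t x = (\<integral>\<^sup>+y\<in>ball x t. ennreal (norm (f y - mean_on (ball x t) f)) \<partial>lebesgue)
      / emeasure lebesgue (ball x t)" for t x
  have cont: "continuous_on UNIV (h t)" if t: "0 < t" for t
  proof -
    have "continuous_on UNIV (\<lambda>x. LINT y:ball x t|lebesgue. f y)"
      using intn by (intro continuous_on_integral_ball exI[of _ "\<lambda>y. norm (f y)"]) auto
    then have m: "continuous_on UNIV (\<lambda>x. mean_on (ball x t) f)"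
      unfolding mean_on_def V(2)[OF t] by (intro continuous_intros)
    have "continuous_on UNIV (\<lambda>x. LINT y:ball x t|lebesgue. norm (f y - mean_on (ball x t) f))"
    proof (rule continuous_on_integral_ball)
      fix R :: real
      \<comment> \<open>The integrand depends on \<open>x\<close> through the mean, which is
        continuous by the previous step and so bounded on compact sets; adding that bound to
        \<open>norm (f y)\<close> gives the dominating function.\<close>
      have "compact ((\<lambda>x. mean_on (ball x t) f) ` cball 0 R)"
        by (intro compact_continuous_image continuous_on_subset[OF m]) auto
      then have "bounded ((\<lambda>x. mean_on (ball x t) f) ` cball 0 R)" by (rule compact_imp_bounded)
      then obtain m0 where m0: "\<And>x. x \<in> cball 0 R \<Longrightarrow> norm (mean_on (ball x t) f) \<le> m0"
        unfolding bounded_iff by blast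
      have "norm (norm (f y - mean_on (ball x t) f)) \<le> norm (f y) + m0" if "x \<in> ball 0 R" for x y
        using m0[of x] that norm_triangle_ineq4[of "f y" "mean_on (ball x t) f"] by simp
      then show "\<exists>w. (\<forall>r. set_integrable lebesgue (ball 0 r) w) \<and>
          (\<forall>x\<in>ball 0 R. \<forall>y. norm (norm (f y - mean_on (ball x t) f)) \<le> w y)"
        by (intro exI[of _ "\<lambda>y. norm (f y) + m0"]) (auto intro: set_integral_add intn intc)
    qed (use m in \<open>auto intro!: continuous_intros\<close>)
    moreover have "h t x = ennreal ((LINT y:ball x t|lebesgue. norm (f y - mean_on (ball x t) f)) / V t)" for x
    proof -
      have "set_integrable lebesgue (ball x t) (\<lambda>y. norm (f y) + norm (mean_on (ball x t) f))"
        by (intro set_integral_add intn intc)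
      moreover have "(\<lambda>y. indicator (ball x t) y *\<^sub>R norm (f y - mean_on (ball x t) f)) \<in> borel_measurable lebesgue"
        by (intro borel_measurable_scaleR borel_measurable_indicator) auto
      ultimately have "set_integrable lebesgue (ball x t) (\<lambda>y. norm (f y - mean_on (ball x t) f))"
        unfolding set_integrable_def
        by (rule Bochner_Integration.integrable_bound) (auto simp: indicator_def norm_triangle_ineq4)
      from set_nn_integral_eq_set_integral[OF this]
      have "h t x = ennreal (LINT y:ball x t|lebesgue. norm (f y - mean_on (ball x t) f)) / ennreal (V t)"
        unfolding h_def V(1)[OF t] by simp
      also have "\<dots> = ennreal ((LINT y:ball x t|lebesgue. norm (f y - mean_on (ball x t) f)) / V t)"
        using V0[OF t] by (intro divide_ennreal) (auto simp: set_lebesgue_integral_def intro!: integral_nonneg_AE)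
      finally show ?thesis .
    qed
    ultimately show ?thesis
      using V0[OF t] by (auto simp: fun_eq_iff intro!: continuous_on_ennreal continuous_intros cong: continuous_on_cong)
  qed
  have "sharp_maximal f \<in> borel_measurable borel"
  proof (rule borel_measurableI_greater)
    fix a :: ennreal
    have "{x \<in> space borel. a < sharp_maximal f x} = (\<Union>t\<in>{0<..}. {x. a < h t x})"
      by (auto simp: sharp_maximal_def h_def less_SUP_iff)
    moreover have "open (\<Union>t\<in>{0<..}. {x. a < h t x})"
      using cont by (intro open_UN ballI open_Collect_less continuous_on_const) auto
    ultimately show "{x \<in> space borel. a < sharp_maximal f x} \<in> sets borel" by simp
  qed
  then have "sharp_maximal f \<in> borel_measurable lborel" by simp
  then show ?thesis by (rule measurable_completion)
qed

text \<open>Where the sharp maximal function is infinite, so is the maximal function of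
  \<open>|f|\<close>. On each \<open>ball 0 (k + 1)\<close> the Morrey bound controls the averages
  over larger radii, so the weak-type argument applies, and these balls exhaust the space.\<close>

lemma sharp_maximal_finite_AE:
  fixes f :: "real ^ 'n \<Rightarrow> 'b::{banach,second_countable_topology}" and l :: real
  assumes f: "f \<in> borel_measurable lebesgue" and p: "1 < p" and l: "l < CARD('n)"
    and A: "0 < A" and M: "morrey_bounded p l A (\<lambda>y. norm (f y))"
  shows "AE x in lebesgue. sharp_maximal f x < \<infinity>"
proof -
  have l': "l < DIM(real ^ 'n)" using l by simp
  have int: "set_integrable lebesgue (ball x r) f" for x r
    by (rule set_integrable_ball_of_morrey_bounded[OF f p l' A M])
  note [measurable] = borel_measurable_sharp_maximal[OF f int]
  have "{x \<in> ball 0 (real (Suc k)). sharp_maximal f x = \<infinity>} \<in> null_sets lebesgue" for k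
  proof (rule null_sets_maximal_function_infinite)
    show "(\<lambda>y. norm (f y)) \<in> borel_measurable lebesgue" using f by simp
    have "{x \<in> ball 0 (real (Suc k)). sharp_maximal f x = \<infinity>}
        = ball 0 (real (Suc k)) \<inter> {x \<in> space lebesgue. sharp_maximal f x = \<infinity>}" by auto
    also have "\<dots> \<in> sets lebesgue" by (intro sets.Int) (simp, measurable)
    finally show "{x \<in> ball 0 (real (Suc k)). sharp_maximal f x = \<infinity>} \<in> sets lebesgue" .
    show "{x \<in> ball 0 (real (Suc k)). sharp_maximal f x = \<infinity>} \<subseteq> ball 0 (real (Suc k))" by blast
    show "maximal_function (\<lambda>y. norm (f y)) y = \<infinity>"
      if "y \<in> {x \<in> ball 0 (real (Suc k)). sharp_maximal f x = \<infinity>}" for y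
      using that sharp_maximal_le_maximal_function[OF f, of y] by (auto simp: top_unique ennreal_mult_eq_top_iff)
    show "(\<integral>\<^sup>+z\<in>ball y t. ennreal (norm (f z)) \<partial>lebesgue)
      \<le> ennreal (2 * (A * unit_ball_vol DIM(real ^ 'n) powr (- 1 / p) * real (Suc k) powr ((l - DIM(real ^ 'n)) / p)))
        * emeasure lebesgue (ball y t)" if "real (Suc k) < t" for y t
      using f that by (intro morrey_average_bound p l' A M) auto
    show "(\<integral>\<^sup>+z\<in>ball 0 (2 * real (Suc k)). ennreal (norm (f z)) \<partial>lebesgue) < \<infinity>"
      using int[of 0 "2 * real (Suc k)"] f by (subst (asm) set_integrable_iff_nn_integral_norm) auto
  qed
  then have "(\<Union>k. {x \<in> ball 0 (real (Suc k)). sharp_maximal f x = \<infinity>}) \<in> null_sets lebesgue"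
    by (rule null_sets_UN)
  moreover have "(\<Union>k. {x \<in> ball 0 (real (Suc k)). sharp_maximal f x = \<infinity>}) = {x. sharp_maximal f x = \<infinity>}"
  proof -
    have "\<exists>k. norm x < real (Suc k)" for x :: "real ^ 'n"
      using reals_Archimedean2[of "norm x"] by (metis less_trans lessI of_nat_less_iff)
    then show ?thesis by auto
  qed
  ultimately have "AE x in lebesgue. x \<notin> {x. sharp_maximal f x = \<infinity>}" by (simp only: AE_not_in)
  then show ?thesis by eventually_elim (auto simp: less_top)
qed

lemma ball_norm_eq: "{y. norm y < norm x} = ball 0 (norm x)" for x :: "'a::real_normed_vector"
  by auto

lemma borel_measurable_hardy:
  fixes f :: "real ^ 'n \<Rightarrow> 'b::{banach,second_countable_topology}"
  assumes [measurable]: "f \<in> borel_measurable lebesgue" and int: "\<And>x r. set_integrable lebesgue (ball x r) f"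
  shows "hardy f \<in> borel_measurable lebesgue"
proof -
  have "set_integrable lebesgue (ball x r) (\<lambda>y. norm (f y))" for x r
    using int[of x r] by (simp add: set_integrable_iff_nn_integral_norm)
  then have "continuous_on UNIV (\<lambda>x::real ^ 'n. LINT y:ball 0 (norm x)|lebesgue. f y)"
    by (intro continuous_on_integral_ball[where F = "\<lambda>x y. f y" and c = "\<lambda>_. 0" and \<rho> = norm]
        exI[of _ "\<lambda>y. norm (f y)"]) (auto intro!: continuous_intros)
  then have [measurable]: "(\<lambda>x::real ^ 'n. LINT y:ball 0 (norm x)|lebesgue. f y) \<in> borel_measurable borel"
    by (rule borel_measurable_continuous_onI)
  have "(\<lambda>x::real ^ 'n. (1 / norm x ^ CARD('n)) *\<^sub>R (LINT y:ball 0 (norm x)|lebesgue. f y)) \<in> borel_measurable lborel"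
    by measurable
  then show ?thesis
    unfolding hardy_def[abs_def] ball_norm_eq by (rule measurable_completion)
qed

text \<open>\<open>ball 0 |x|\<close> lies in \<open>ball x (2 |x|)\<close>, and the constant is the
  volume of the latter divided by \<open>|x|^n\<close>. At \<open>x = 0\<close> the left-hand side
  is \<open>0\<close>, the domain of integration being empty.\<close>

lemma hardy_le_maximal_function:
  fixes f :: "real ^ 'n \<Rightarrow> 'b::{banach,second_countable_topology}"
  shows "ennreal (norm (hardy f x)) \<le> ennreal (unit_ball_vol CARD('n) * 2 ^ CARD('n)) * maximal_function (\<lambda>y. norm (f y)) x"
proof (cases "x = 0")
  case False
  let ?n = "CARD('n)"
  let ?c = "unit_ball_vol ?n * 2 ^ ?n"
  let ?I = "\<integral>\<^sup>+y\<in>ball x (2 * norm x). ennreal (norm (f y)) \<partial>lebesgue"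
  have c: "unit_ball_vol ?n \<noteq> 0" using unit_ball_vol_pos[of ?n] by (metis less_irrefl of_nat_0_le_iff)
  have x: "0 < norm x ^ ?n" using False by simp
  have B: "emeasure lebesgue (ball x (2 * norm x)) = ennreal (?c * norm x ^ ?n)"
    by (simp add: emeasure_ball power_mult_distrib mult.assoc)
  have sub: "ball 0 (norm x) \<subseteq> ball x (2 * norm x)"
  proof
    fix y :: "real ^ 'n" assume "y \<in> ball 0 (norm x)"
    then show "y \<in> ball x (2 * norm x)" using norm_triangle_ineq4[of x y] by (simp add: dist_norm)
  qed
  have "ennreal (norm (hardy f x)) = ennreal (norm (LINT y:ball 0 (norm x)|lebesgue. f y)) / ennreal (norm x ^ ?n)"
    using x by (simp add: hardy_def ball_norm_eq divide_ennreal)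
  also have "\<dots> \<le> (\<integral>\<^sup>+y\<in>ball 0 (norm x). ennreal (norm (f y)) \<partial>lebesgue) / ennreal (norm x ^ ?n)"
    by (intro divide_right_mono_ennreal norm_set_integral_le_nn_integral)
  also have "\<dots> \<le> ?I / ennreal (norm x ^ ?n)"
    using sub by (intro divide_right_mono_ennreal nn_integral_mono) (auto simp: indicator_def)
  also have "\<dots> = ennreal ?c * (?I / ennreal (?c * norm x ^ ?n))"
  proof (cases ?I)
    case (real J)
    then show ?thesis
      using c x by (simp add: divide_ennreal flip: ennreal_mult)
  next
    case top
    then show ?thesis using c x by (simp add: ennreal_top_divide ennreal_mult_top)
  qed
  also have "?I / ennreal (?c * norm x ^ ?n) \<le> maximal_function (\<lambda>y. norm (f y)) x"
    unfolding maximal_function_def using False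
    by (intro SUP_upper2[of "2 * norm x"]) (auto simp: B simp del: emeasure_completion)
  finally show ?thesis by (simp add: mult_left_mono)
qed (simp add: hardy_def set_lebesgue_integral_def)

lemma borel_measurable_hardy_dual:
  fixes f :: "real ^ 'n \<Rightarrow> 'b::{banach,second_countable_topology}"
  assumes [measurable]: "f \<in> borel_measurable lebesgue"
    and fin: "\<And>s. 0 < s \<Longrightarrow> (\<integral>\<^sup>+y\<in>{y. s < norm y}. ennreal (norm (f y) / norm y ^ CARD('n)) \<partial>lebesgue) < \<infinity>"
  shows "hardy_dual f \<in> borel_measurable lebesgue"
proof -
  note nm [measurable] = borel_measurable_lebesgue_norm[where 'a="real ^ 'n"]
  have "continuous_on (- {0}) (\<lambda>x::real ^ 'n. LINT y:{y. norm x - norm y < 0}|lebesgue. (1 / norm y ^ CARD('n)) *\<^sub>R f y)"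
  proof (rule continuous_on_parametric_integral)
    fix x :: "real ^ 'n" assume x: "x \<in> - {0}"
    have "sphere (0 :: real ^ 'n) (norm x) = {y. norm x - norm y = 0}" by auto
    then show "{y::real ^ 'n. norm x - norm y = 0} \<in> null_sets lebesgue"
      using negligible_sphere[of "0 :: real ^ 'n" "norm x"] by (simp add: negligible_iff_null_sets)
    show "{y::real ^ 'n. norm x - norm y < 0} \<in> sets lebesgue"
      using sets_lebesgue_norm_ge(2)[of "norm x"] by simp
    \<comment> \<open>For points within \<open>s\<close> of \<open>x\<close> the region of
      integration stays in \<open>|y| > s\<close>, away from the singularity of
      \<open>1 / |y|^n\<close>; \<open>fin\<close> makes the dominating function integrable
      there.\<close>
    define s where "s = norm x / 2"
    define w where "w y = indicator {y. s < norm y} y *\<^sub>R (norm (f y) / norm y ^ CARD('n))" for y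
    have s: "0 < s" using x by (simp add: s_def)
    have "integrable lebesgue w"
      using fin[OF s] unfolding w_def set_integrable_def[symmetric]
      by (subst set_integrable_iff_nn_integral_norm) auto
    moreover have "norm ((1 / norm y ^ CARD('n)) *\<^sub>R f y) \<le> w y" if "z \<in> ball x s" "norm z - norm y < 0" for z y
    proof -
      have "norm x \<le> norm z + dist x z" using norm_triangle_sub[of x z] by (simp add: dist_norm)
      then have "s < norm y" using that by (simp add: s_def)
      then show ?thesis by (simp add: w_def)
    qed
    ultimately show "\<exists>d>0. \<exists>w. integrable lebesgue w \<and>
        (\<forall>z\<in>- {0} \<inter> ball x d. \<forall>y. norm z - norm y < 0 \<longrightarrow> norm ((1 / norm y ^ CARD('n)) *\<^sub>R f y) \<le> w y) \<and> (\<forall>y. 0 \<le> w y)"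
      using s by (intro exI[of _ s] conjI exI[of _ w]) (auto simp: w_def)
  qed (auto intro!: continuous_intros)
  then have "continuous_on (- {0}) (hardy_dual f)" by (simp add: hardy_dual_def[abs_def])
  \<comment> \<open>Nothing is known about continuity at the origin, but one exceptional point does
    not harm measurability.\<close>
  then have "hardy_dual f \<in> borel_measurable borel"
    by (intro borel_measurable_continuous_countable_exceptions[of "{0}"]) auto
  then have "hardy_dual f \<in> borel_measurable lborel" by simp
  then show ?thesis by (rule measurable_completion)
qed

theorem theorem3p6:
  fixes p l :: real
  assumes "1 < p" and "0 \<le> l" and "l < real CARD('n::finite)"
  shows "bounded_in_vanishing_morrey p l sharp_maximal_defined
           (\<lambda>(f :: real ^ 'n \<Rightarrow> 'k::{real_normed_field,banach,second_countable_topology}) x.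
              enn2real (sharp_maximal f x))
       \<and> bounded_in_vanishing_morrey p l hardy_defined
           (hardy :: (real ^ 'n \<Rightarrow> 'k) \<Rightarrow> real ^ 'n \<Rightarrow> 'k)
       \<and> bounded_in_vanishing_morrey p l hardy_dual_defined
           (hardy_dual :: (real ^ 'n \<Rightarrow> 'k) \<Rightarrow> real ^ 'n \<Rightarrow> 'k)"
proof -
  note p = assms(1) and l0 = assms(2)
  let ?n = "CARD('n)"
  have l: "l < DIM(real ^ 'n)" using assms(3) by simp
  \<comment> \<open>The constant of the maximal estimate without its domination factor, which is
    \<open>2\<close> for the sharp maximal function and \<open>unit_ball_vol ?n * 2 ^ ?n\<close> for
    the Hardy operator.\<close>
  define K where "K = (2 * 5 ^ DIM(real ^ 'n) * (p * 2 powr (p - 1) / (p - 1)) * 2 powr l + 2 powr p) powr (1 / p)"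
  have K: "0 < K"
  proof -
    have "0 < 2 * 5 ^ DIM(real ^ 'n) * (p * 2 powr (p - 1) / (p - 1)) * 2 powr l + 2 powr p"
      using p by (intro add_pos_pos mult_pos_pos divide_pos_pos) auto
    then show ?thesis by (simp add: K_def)
  qed
  note int = set_integrable_ball_of_morrey_bounded[OF _ p l]
  have sharp: "bounded_in_vanishing_morrey p l sharp_maximal_defined
           (\<lambda>(f :: real ^ 'n \<Rightarrow> 'k) x. enn2real (sharp_maximal f x))"
  proof (rule bounded_in_vanishing_morreyI[OF p, of "2 * K"])
    fix f :: "real ^ 'n \<Rightarrow> 'k" and A
    assume f: "f \<in> borel_measurable lebesgue" and A: "0 < A" and M: "morrey_bounded p l A (\<lambda>y. norm (f y))"
      and van: "uniformly_vanishing p (\<lambda>y. norm (f y))"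
    have g: "(\<lambda>x. enn2real (sharp_maximal f x)) \<in> borel_measurable lebesgue"
      using borel_measurable_sharp_maximal[OF f int[OF f A M]] by simp
    \<comment> \<open>\<open>enn2real\<close> turns \<open>\<infinity>\<close> into
      \<open>0\<close>, so the bound survives where the sharp maximal function is infinite.\<close>
    have dom: "ennreal (enn2real (sharp_maximal f y)) \<le> ennreal 2 * maximal_function (\<lambda>y. norm (f y)) y" for y
      using sharp_maximal_le_maximal_function[OF f, of y]
      by (cases "sharp_maximal f y") auto
    show "sharp_maximal_defined f \<and> (\<lambda>x. enn2real (sharp_maximal f x)) \<in> borel_measurable lebesgue \<and>
      morrey_bounded p l (2 * K * A) (\<lambda>y. norm (enn2real (sharp_maximal f y))) \<and>
      uniformly_vanishing p (\<lambda>y. norm (enn2real (sharp_maximal f y)))"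
      using sharp_maximal_finite_AE[OF f p assms(3) A M] int[OF f A M] g
        morrey_bounded_maximal[OF _ g _ _ p l0 l _ A M dom]
        uniformly_vanishing_maximal[OF _ g _ _ p l _ A M van dom] f
      by (simp add: sharp_maximal_defined_def K_def)
  qed (use K in simp)
  have hardy: "bounded_in_vanishing_morrey p l hardy_defined (hardy :: (real ^ 'n \<Rightarrow> 'k) \<Rightarrow> real ^ 'n \<Rightarrow> 'k)"
  proof (rule bounded_in_vanishing_morreyI[OF p, of "unit_ball_vol ?n * 2 ^ ?n * K"])
    fix f :: "real ^ 'n \<Rightarrow> 'k" and A
    assume f: "f \<in> borel_measurable lebesgue" and A: "0 < A" and M: "morrey_bounded p l A (\<lambda>y. norm (f y))"
      and van: "uniformly_vanishing p (\<lambda>y. norm (f y))"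
    have g: "(\<lambda>x. norm (hardy f x)) \<in> borel_measurable lebesgue"
      using borel_measurable_hardy[OF f int[OF f A M]] by simp
    show "hardy_defined f \<and> hardy f \<in> borel_measurable lebesgue \<and>
      morrey_bounded p l (unit_ball_vol ?n * 2 ^ ?n * K * A) (\<lambda>y. norm (hardy f y)) \<and>
      uniformly_vanishing p (\<lambda>y. norm (hardy f y))"
      using int[OF f A M] borel_measurable_hardy[OF f int[OF f A M]]
        morrey_bounded_maximal[OF _ g _ _ p l0 l _ A M hardy_le_maximal_function]
        uniformly_vanishing_maximal[OF _ g _ _ p l _ A M van hardy_le_maximal_function] f
      by (simp add: hardy_defined_def ball_norm_eq K_def)
  qed (use K in simp)
  have dual: "bounded_in_vanishing_morrey p l hardy_dual_defined (hardy_dual :: (real ^ 'n \<Rightarrow> 'k) \<Rightarrow> real ^ 'n \<Rightarrow> 'k)"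
  proof (rule hardy_dual_estimates[OF p l0 l])
    fix C
    assume C: "0 < C"
      and fin: "\<And>(u :: real ^ 'n \<Rightarrow> real) A s. \<lbrakk>u \<in> borel_measurable lebesgue; \<And>y. 0 \<le> u y; 0 < A; morrey_bounded p l A u; 0 < s\<rbrakk>
        \<Longrightarrow> (\<integral>\<^sup>+y\<in>{y. s < norm y}. ennreal (u y / norm y ^ DIM(real ^ 'n)) \<partial>lebesgue) < \<infinity>"
      and bd: "\<And>(u :: real ^ 'n \<Rightarrow> real) (g :: real ^ 'n \<Rightarrow> real) A. \<lbrakk>u \<in> borel_measurable lebesgue; \<And>y. 0 \<le> u y; g \<in> borel_measurable lebesgue;
        \<And>y. 0 \<le> g y; 0 < A; morrey_bounded p l A u;
        \<And>x. x \<noteq> 0 \<Longrightarrow> ennreal (g x) \<le> (\<integral>\<^sup>+y\<in>{y. norm x < norm y}. ennreal (u y / norm y ^ DIM(real ^ 'n)) \<partial>lebesgue)\<rbrakk>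
        \<Longrightarrow> morrey_bounded p l (C * A) g \<and> uniformly_vanishing p g"
    show ?thesis
    proof (rule bounded_in_vanishing_morreyI[OF p C])
      fix f :: "real ^ 'n \<Rightarrow> 'k" and A
      assume f: "f \<in> borel_measurable lebesgue" and A: "0 < A" and M: "morrey_bounded p l A (\<lambda>y. norm (f y))"
      note nm [measurable] = borel_measurable_lebesgue_norm[where 'a="real ^ 'n"]
      have fin': "(\<integral>\<^sup>+y\<in>{y. s < norm y}. ennreal (norm (f y) / norm y ^ ?n) \<partial>lebesgue) < \<infinity>" if "0 < s" for s
        using fin[of "\<lambda>y. norm (f y)" A s] f A M that by simp
      have meas: "hardy_dual f \<in> borel_measurable lebesgue"
        by (rule borel_measurable_hardy_dual[OF f fin'])
      have "ennreal (norm (hardy_dual f x)) \<le> (\<integral>\<^sup>+y\<in>{y. norm x < norm y}. ennreal (norm (f y) / norm y ^ ?n) \<partial>lebesgue)" for x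
        using norm_set_integral_le_nn_integral[where S="{y. norm x < norm y}" and M=lebesgue and f="\<lambda>y. (1 / norm y ^ ?n) *\<^sub>R f y"]
        by (simp add: hardy_dual_def)
      then have "morrey_bounded p l (C * A) (\<lambda>y. norm (hardy_dual f y)) \<and> uniformly_vanishing p (\<lambda>y. norm (hardy_dual f y))"
        using f meas A M by (intro bd[of "\<lambda>y. norm (f y)"]) auto
      moreover have "hardy_dual_defined f"
        unfolding hardy_dual_defined_def
      proof -
        have "AE x in lborel. x \<noteq> (0 :: real ^ 'n)" by (rule AE_lborel_singleton)
        then have "AE x in lebesgue. x \<noteq> (0 :: real ^ 'n)" by (rule AE_completion)
        then show "AE x::real ^ 'n in lebesgue. set_integrable lebesgue {y. norm y > norm x} (\<lambda>y. (1 / norm y ^ ?n) *\<^sub>R f y)"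
        proof eventually_elim
          case (elim x)
          have "(\<lambda>y. (1 / norm y ^ ?n) *\<^sub>R f y) \<in> borel_measurable lebesgue"
            using f by measurable
          then show ?case
            using fin'[of "norm x"] elim by (subst set_integrable_iff_nn_integral_norm) auto
        qed
      qed
      ultimately show "hardy_dual_defined f \<and> hardy_dual f \<in> borel_measurable lebesgue \<and>
          morrey_bounded p l (C * A) (\<lambda>y. norm (hardy_dual f y)) \<and> uniformly_vanishing p (\<lambda>y. norm (hardy_dual f y))"
        using meas by blast
    qed
  qed
  show ?thesis using sharp hardy dual by blast
qed

end
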